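(* Let $d_1,d_2\ge 2$ be integers, at least one of which is greater than $2$, and let $r_1\ge q_1\ge 1$ and $r_2\ge q_2\ge 1$ be integers with $r_1+q_1=d_1$ and $r_2+q_2=d_2$. Let $\mathfrak{k}=\mathrm{span}\{i\sigma^1\otimes S^2,\ iS^1\otimes\sigma^2\}$, and let $$\mathfrak{k}'=\mathrm{span}\{i\sigma^{1,D}\otimes S^{2,D},\ iS^{1,D}\otimes\sigma^{2,D},\ i\sigma^{1,A}\otimes S^{2,A},\ iS^{1,A}\otimes\sigma^{2,A}\},$$ $$\mathfrak{p}'=\mathrm{span}\{i\sigma^{1,A}\otimes S^{2,D},\ i\sigma^{1,D}\otimes S^{2,A},\ iS^{1,D}\otimes\sigma^{2,A},\ iS^{1,A}\otimes\sigma^{2,D}\},$$ where the symbols range over the types of matrices defined in the context. Then $\mathfrak{k}=\mathfrak{k}'\oplus\mathfrak{p}'$ is a Cartan decomposition of $\mathfrak{k}$, i.e. $$[\mathfrak{k}',\mathfrak{k}']\subseteq\mathfrak{k}',\qquad [\mathfrak{k}',\mathfrak{p}']\subseteq\mathfrak{p}',\qquad [\mathfrak{p}',\mathfrak{p}']\subseteq\mathfrak{k}'.$$ As a decomposition of $\mathfrak{so}(d_1d_2)$, it is a Cartan decomposition of type BDI with indices $r$ and $q$ satisfying $r\ge q\ge 1$, $r+q=d_1d_2$, where $$r=r_1r_2+q_1q_2,\qquad q=r_1q_2+q_1r_2.$$ Accordingly, the dimension of any associated Cartan subalgebra $\mathfrak{a}'\subseteq\mathfrak{p}'$ is $q=r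_1q_2+q_1r_2$.
   Context: All spans are over $\mathbb{R}$. $\otimes$ is the Kronecker product of matrices and $[\cdot,\cdot]$ the matrix commutator. The inner product on spaces of skew-Hermitian matrices is $\langle A,B\rangle=\mathrm{Tr}(AB^* )$. For $j=1,2$: - $\sigma^j$ denotes a generic element of an orthogonal basis of $i\,\mathfrak{so}(d_j)$, so that $i\sigma^j$ is a real skew-symmetric $d_j\times d_j$ matrix; $S^j$ denotes a generic element of an orthogonal basis of $i\,\mathfrak{so}(d_j)^\perp$, with the orthogonal complement taken in $\mathfrak{u}(d_j)$, so that $S^j$ is a real symmetric $d_j\times d_j$ matrix. A span written with these symbols is the real span over all matrices of the indicated types. (The Lie algebra $\mathfrak{k}\subseteq\mathfrak{u}(d_1d_2)$ is isomorphic to $\mathfrak{so}(d_1d_2)$, and is regarded as such.) - Matrices of size $d_j\times d_j$ are partitioned into blocks according to $d_j=r_j+q_j$ (upper diagonal block $r_j\times r_j$, lower diagonal block $q_j\times q_j$). $\sigma^{j,D}$ (resp. $\sigma^{j,A}$) denotes a matrix of type $\sigma^j$ that is block diagonal (resp. block anti-diagonal, i.e. with zero diagonal blocks); $S^{j,D}$ (resp. $S^{j,A}$) denotes a matrix of type $S^j$ that is block diagonal (resp. block anti-diagonal). A Cartan decomposition of a semisimple Lie algebra $\mathfrak{l}$ is a vector space decomposition $\mathfrak{l}=\mathfrak{k}_0\oplus\mathfrak{p}_0$ with $\mathfrak{p}_0=\mathfrak{k}_0^\perp$, $[\mathfrak{k}_0,\mathfrak{k}_0]\subseteq\mathfrak{k}_0$,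 $[\mathfrak{p}_0,\mathfrak{k}_0]\subseteq\mathfrak{p}_0$, $[\mathfrak{p}_0,\mathfrak{p}_0]\subseteq\mathfrak{k}_0$. An associated Cartan subalgebra is a maximal abelian subalgebra contained in $\mathfrak{p}_0$. A Cartan decomposition of $\mathfrak{so}(n)$ is of type BDI with indices $r\ge q\ge1$, $r+q=n$, if, up to a conjugacy $L\mapsto MLM^{-1}$ with $M\in SO(n)$, $\mathfrak{k}_0$ consists of all matrices $\begin{pmatrix}A&0\\0&B\end{pmatrix}$ with $A\in\mathfrak{so}(r)$, $B\in\mathfrak{so}(q)$, and $\mathfrak{p}_0$ consists of all matrices $\begin{pmatrix}0&C\\-C^T&0\end{pmatrix}$ with $C$ an arbitrary real $r\times q$ matrix. *)

theory Defs
  imports "HOL-Analysis.Analysis"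
begin

section \<open>Matrix Lie algebras\<close>

text \<open>
  All matrices have complex entries and are indexed by a finite type. Since
  complex matrices form a type of class \<^class>\<open>euclidean_space\<close>, the constants \<^const>\<open>span\<close>,
  \<^const>\<open>subspace\<close> and \<^const>\<open>dim\<close> refer to real linear combinations.
\<close>

definition complexify :: "real^'n^'m \<Rightarrow> complex^'n^'m" where
  "complexify = map_matrix complex_of_real"

definition conj_transpose :: "complex^'n^'m \<Rightarrow> complex^'m^'n" where
  "conj_transpose A = (\<chi> i j. cnj (A $ j $ i))"

definition trace_inner :: "complex^'n^'n \<Rightarrow> complex^'n^'n \<Rightarrow> complex" where
  "trace_inner A B = trace (A ** conj_transpose B)"

definition commutator :: "complex^'n^'n \<Rightarrow> complex^'n^'n \<Rightarrow> complex^'n^'n" where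
  "commutator A B = A ** B - B ** A"

definition cscale :: "complex \<Rightarrow> complex^'n^'m \<Rightarrow> complex^'n^'m" where
  "cscale c A = (\<chi> i j. c * A $ i $ j)"

definition kronecker ::
  "complex^'n1^'m1 \<Rightarrow> complex^'n2^'m2 \<Rightarrow> complex^('n1 \<times> 'n2)^('m1 \<times> 'm2)" where
  "kronecker A B = (\<chi> i j. A $ fst i $ fst j * B $ snd i $ snd j)"

definition u_alg :: "(complex^'n^'n) set" where
  "u_alg = {A. conj_transpose A = - A}"

definition so_alg :: "(complex^'n^'n) set" where
  "so_alg = complexify ` {A :: real^'n^'n. transpose A = - A}"

definition so_perp :: "(complex^'n^'n) set" where
  "so_perp = {A \<in> u_alg. \<forall>B \<in> so_alg. trace_inner A B = 0}"


section \<open>Semisimplicity and Cartan decompositions\<close>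

definition lie_subalgebra :: "(complex^'n^'n) set \<Rightarrow> bool" where
  "lie_subalgebra L \<longleftrightarrow> subspace L \<and> (\<forall>A \<in> L. \<forall>B \<in> L. commutator A B \<in> L)"

definition lie_ideal :: "(complex^'n^'n) set \<Rightarrow> (complex^'n^'n) set \<Rightarrow> bool" where
  "lie_ideal I L \<longleftrightarrow> subspace I \<and> I \<subseteq> L \<and> (\<forall>A \<in> L. \<forall>B \<in> I. commutator A B \<in> I)"

definition derived_algebra :: "(complex^'n^'n) set \<Rightarrow> (complex^'n^'n) set" where
  "derived_algebra L = span {commutator A B | A B. A \<in> L \<and> B \<in> L}"

definition solvable_alg :: "(complex^'n^'n) set \<Rightarrow> bool" where
  "solvable_alg L \<longleftrightarrow> (\<exists>k. (derived_algebra ^^ k) L = {0})"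

definition semisimple_alg :: "(complex^'n^'n) set \<Rightarrow> bool" where
  "semisimple_alg L \<longleftrightarrow>
     lie_subalgebra L \<and> (\<forall>I. lie_ideal I L \<and> solvable_alg I \<longrightarrow> I = {0})"

definition cartan_decomposition ::
  "(complex^'n^'n) set \<Rightarrow> (complex^'n^'n) set \<Rightarrow> (complex^'n^'n) set \<Rightarrow> bool" where
  "cartan_decomposition L k0 p0 \<longleftrightarrow>
     semisimple_alg L \<and>
     subspace k0 \<and> subspace p0 \<and>
     L = {X + Y | X Y. X \<in> k0 \<and> Y \<in> p0} \<and> k0 \<inter> p0 = {0} \<and>
     p0 = {X \<in> L. \<forall>Y \<in> k0. trace_inner X Y = 0} \<and>
     (\<forall>X \<in> k0. \<forall>Y \<in> k0. commutator X Y \<in> k0) \<and>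
     (\<forall>X \<in> p0. \<forall>Y \<in> k0. commutator X Y \<in> p0) \<and>
     (\<forall>X \<in> p0. \<forall>Y \<in> p0. commutator X Y \<in> k0)"

definition abelian_subalgebra :: "(complex^'n^'n) set \<Rightarrow> bool" where
  "abelian_subalgebra a \<longleftrightarrow> lie_subalgebra a \<and> (\<forall>X \<in> a. \<forall>Y \<in> a. commutator X Y = 0)"

text \<open>Maximality is among the abelian subalgebras contained in \<open>p0\<close>, not among all abelian
  subalgebras of the ambient Lie algebra.\<close>

definition cartan_subalgebra :: "(complex^'n^'n) set \<Rightarrow> (complex^'n^'n) set \<Rightarrow> bool" where
  "cartan_subalgebra p0 a \<longleftrightarrow>
     abelian_subalgebra a \<and> a \<subseteq> p0 \<and>
     (\<forall>b. abelian_subalgebra b \<and> a \<subseteq> b \<and> b \<subseteq> p0 \<longrightarrow> b = a)"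


section \<open>Block structure and type BDI\<close>

text \<open>
  An index type carries no order, so a partition of the indices into an upper and a
  lower block is given by the set \<open>U\<close> of the indices of the upper block; the lower block is
  its complement.
\<close>

definition block_diagonal :: "'n set \<Rightarrow> complex^'n^'n \<Rightarrow> bool" where
  "block_diagonal U A \<longleftrightarrow> (\<forall>i j. (i \<in> U) \<noteq> (j \<in> U) \<longrightarrow> A $ i $ j = 0)"

definition block_antidiagonal :: "'n set \<Rightarrow> complex^'n^'n \<Rightarrow> bool" where
  "block_antidiagonal U A \<longleftrightarrow> (\<forall>i j. (i \<in> U) = (j \<in> U) \<longrightarrow> A $ i $ j = 0)"

text \<open>The standard BDI pair: matrices with diagonal blocks \<open>A\<close>, \<open>B\<close>
  (both skew-symmetric), and matrices with off-diagonal blocks \<open>C\<close> and \<open>- C\<^sup>T\<close>. Only the entries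
  of \<open>A\<close>, \<open>B\<close>, \<open>C\<close> at the positions of the respective block matter.\<close>

definition bdi_k :: "'n::finite set \<Rightarrow> (complex^'n^'n) set" where
  "bdi_k U =
     {complexify (\<chi> i j. if i \<in> U \<and> j \<in> U then A i j
                         else if i \<notin> U \<and> j \<notin> U then B i j else 0)
      | A B. (\<forall>i \<in> U. \<forall>j \<in> U. A j i = - A i j) \<and> (\<forall>i \<in> - U. \<forall>j \<in> - U. B j i = - B i j)}"

definition bdi_p :: "'n::finite set \<Rightarrow> (complex^'n^'n) set" where
  "bdi_p U =
     {complexify (\<chi> i j. if i \<in> U \<and> j \<notin> U then C i j
                         else if i \<notin> U \<and> j \<in> U then - C j i else 0)
      | C. True}"

definition conjugate_by :: "real^'n^'n \<Rightarrow> complex^'n^'n \<Rightarrow> complex^'n^'n" where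
  "conjugate_by M L = complexify M ** L ** matrix_inv (complexify M)"

text \<open>The conjugacy is required for every choice \<open>U\<close> of \<open>r\<close> indices as the upper block, hence
  for the first \<open>r\<close> indices in any ordering of the index type.\<close>

definition cartan_decomposition_BDI ::
  "nat \<Rightarrow> nat \<Rightarrow> (complex^'n^'n) set \<Rightarrow> (complex^'n^'n) set \<Rightarrow> bool" where
  "cartan_decomposition_BDI r q k0 p0 \<longleftrightarrow>
     cartan_decomposition so_alg k0 p0 \<and>
     r \<ge> q \<and> q \<ge> 1 \<and> r + q = CARD('n) \<and>
     (\<forall>U :: 'n set. card U = r \<longrightarrow>
        (\<exists>M. rotation_matrix M \<and>
             k0 = conjugate_by M ` bdi_k U \<and> p0 = conjugate_by M ` bdi_p U))"


section \<open>The bipartite decomposition\<close>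

definition sigma_mats :: "(complex^'n^'n) set" where
  "sigma_mats = cscale \<i> ` so_alg"

definition S_mats :: "(complex^'n^'n) set" where
  "S_mats = cscale \<i> ` so_perp"

definition sigma_D :: "'n set \<Rightarrow> (complex^'n^'n) set" where
  "sigma_D U = {A \<in> sigma_mats. block_diagonal U A}"

definition sigma_A :: "'n set \<Rightarrow> (complex^'n^'n) set" where
  "sigma_A U = {A \<in> sigma_mats. block_antidiagonal U A}"

definition S_D :: "'n set \<Rightarrow> (complex^'n^'n) set" where
  "S_D U = {A \<in> S_mats. block_diagonal U A}"

definition S_A :: "'n set \<Rightarrow> (complex^'n^'n) set" where
  "S_A U = {A \<in> S_mats. block_antidiagonal U A}"

definition i_tensor ::
  "(complex^'a^'a) set \<Rightarrow> (complex^'b^'b) set \<Rightarrow> (complex^('a \<times> 'b)^('a \<times> 'b)) set" where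
  "i_tensor P Q = {kronecker (cscale \<i> A) B | A B. A \<in> P \<and> B \<in> Q}"

definition frak_k :: "(complex^('a::finite \<times> 'b::finite)^('a \<times> 'b)) set" where
  "frak_k = span (i_tensor sigma_mats S_mats \<union> i_tensor S_mats sigma_mats)"

definition frak_k' :: "'a::finite set \<Rightarrow> 'b::finite set \<Rightarrow> (complex^('a \<times> 'b)^('a \<times> 'b)) set" where
  "frak_k' U1 U2 = span
     (i_tensor (sigma_D U1) (S_D U2) \<union> i_tensor (S_D U1) (sigma_D U2) \<union>
      i_tensor (sigma_A U1) (S_A U2) \<union> i_tensor (S_A U1) (sigma_A U2))"

definition frak_p' :: "'a::finite set \<Rightarrow> 'b::finite set \<Rightarrow> (complex^('a \<times> 'b)^('a \<times> 'b)) set" where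
  "frak_p' U1 U2 = span
     (i_tensor (sigma_A U1) (S_D U2) \<union> i_tensor (sigma_D U1) (S_A U2) \<union>
      i_tensor (S_D U1) (sigma_A U2) \<union> i_tensor (S_A U1) (sigma_D U2))"

end

theory Submission
  imports Defs
begin

text \<open>The algebra \<open>frak_k\<close> is all of \<open>so_alg\<close>, because a skew-symmetric matrix unit at a position
  \<open>((i, k), (j, l))\<close> is half the sum of a skew \<open>\<otimes>\<close> symmetric and a symmetric \<open>\<otimes>\<close> skew product of
  matrix units. The same identity shows that \<open>k'\<close> and \<open>p'\<close> are the block diagonal and block
  antidiagonal parts of \<open>so_alg\<close> for the index set \<open>U1 \<times> U2 \<union> (- U1) \<times> (- U2)\<close>, which has
  \<open>r1 r2 + q1 q2\<close> elements. A permutation of the indices, which can be chosen even, conjugates this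
  decomposition to the standard one of type BDI. Semisimplicity follows since an abelian ideal is
  central by invariance of the trace form, and the centre is trivial. An abelian subalgebra of
  \<open>p'\<close> is a family of rectangular matrices admitting a simultaneous singular value decomposition,
  so a maximal one has one dimension for each index of the smaller block.\<close>

section \<open>Real skew-symmetric matrices and the type symbols\<close>

text \<open>The index set for the tensor product comes from an involution. Let \<open>J\<close> be
  the Kronecker product of two diagonal sign matrices, each \<open>+1\<close> on its upper block and
  \<open>-1\<close> on the lower one. A block diagonal factor commutes with its sign matrix and a
  block antidiagonal one anticommutes, so an even number of antidiagonal factors commutes with
  \<open>J\<close> and an odd number anticommutes. The \<open>+1\<close> indices of \<open>J\<close>
  form the large block, and its trace \<open>(r1 - q1) * (r2 - q2)\<close> is the difference of the
  two indices. The dimension claim meets an obstacle: elements of \<open>p'\<close> exchange the two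
  blocks and, being skew, have no nonzero real eigenvalue. The product of two commuting ones is
  symmetric and preserves each block. Eigenvectors are therefore sought for products in the smaller
  block and then paired with vectors in the larger one.\<close>

lemma complexify_component [simp]: "complexify A $ i $ j = complex_of_real (A $ i $ j)"
  by (simp add: complexify_def map_matrix_def)

lemma so_alg_iff:
  fixes A :: "complex^'n^'n"
  shows "A \<in> so_alg \<longleftrightarrow> (\<forall>i j. A $ i $ j \<in> \<real>) \<and> (\<forall>i j. A $ j $ i = - A $ i $ j)"
proof
  assume "A \<in> so_alg"
  then obtain B :: "real^'n^'n" where B: "A = complexify B" "transpose B = - B"
    unfolding so_alg_def by blast
  have "B $ j $ i = - B $ i $ j" for i j
    using arg_cong[OF B(2), of "\<lambda>M. M $ i $ j"] by (simp add: transpose_def)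
  then have "A $ j $ i = - A $ i $ j" for i j
    unfolding B(1) complexify_component by (metis of_real_minus)
  moreover have "A $ i $ j \<in> \<real>" for i j by (simp add: B(1))
  ultimately show "(\<forall>i j. A $ i $ j \<in> \<real>) \<and> (\<forall>i j. A $ j $ i = - A $ i $ j)" by blast
next
  assume A: "(\<forall>i j. A $ i $ j \<in> \<real>) \<and> (\<forall>i j. A $ j $ i = - A $ i $ j)"
  define B where "B = (\<chi> i j. Re (A $ i $ j))"
  have "transpose B $ i $ j = (- B) $ i $ j" for i j
  proof -
    have "A $ j $ i = - A $ i $ j" using A by blast
    then show ?thesis by (simp add: B_def transpose_def)
  qed
  then have "transpose B = - B" by (simp add: vec_eq_iff)
  moreover have "A = complexify B"
    using conjunct1[OF A] by (simp add: B_def vec_eq_iff)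
  ultimately show "A \<in> so_alg" unfolding so_alg_def by blast
qed

lemma so_algI:
  assumes "\<And>i j. A $ i $ j \<in> \<real>" "\<And>i j. A $ j $ i = - A $ i $ j"
  shows "A \<in> so_alg"
  unfolding so_alg_iff using assms by blast

lemma so_alg_real: "A \<in> so_alg \<Longrightarrow> A $ i $ j \<in> \<real>"
  unfolding so_alg_iff by blast

lemma so_alg_skew: "A \<in> so_alg \<Longrightarrow> A $ j $ i = - A $ i $ j"
  unfolding so_alg_iff by blast

lemma subspace_so_alg: "subspace so_alg"
  unfolding subspace_def
proof (intro conjI ballI allI)
  fix A B :: "complex^'n^'n" and c :: real
  assume A: "A \<in> so_alg"
  show "c *\<^sub>R A \<in> so_alg"
  proof (rule so_algI)
    fix i j
    show "(c *\<^sub>R A) $ i $ j \<in> \<real>" using so_alg_real[OF A] by (simp add: scaleR_conv_of_real[where 'a = complex])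
    show "(c *\<^sub>R A) $ j $ i = - (c *\<^sub>R A) $ i $ j" using so_alg_skew[OF A, of j i] by simp
  qed
  assume B: "B \<in> so_alg"
  show "A + B \<in> so_alg"
  proof (rule so_algI)
    fix i j
    show "(A + B) $ i $ j \<in> \<real>" using so_alg_real[OF A] so_alg_real[OF B] by simp
    show "(A + B) $ j $ i = - (A + B) $ i $ j"
      using so_alg_skew[OF A, of j i] so_alg_skew[OF B, of j i] by simp
  qed
qed (auto intro: so_algI)

section \<open>Skew and symmetric matrix units, and the trace pairing\<close>

definition sym_alg :: "(complex^'n^'n) set" where
  "sym_alg = {A. \<forall>i j. A $ i $ j \<in> \<real> \<and> A $ j $ i = A $ i $ j}"

definition skew_unit :: "'n \<Rightarrow> 'n \<Rightarrow> complex^'n^'n" where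
  "skew_unit i j = (\<chi> a b. (if a = i \<and> b = j then 1 else 0) - (if a = j \<and> b = i then 1 else 0))"

definition sym_unit :: "'n \<Rightarrow> 'n \<Rightarrow> complex^'n^'n" where
  "sym_unit i j = (\<chi> a b. (if a = i \<and> b = j then 1 else 0) + (if a = j \<and> b = i then 1 else 0))"

lemma skew_unit_so_alg: "skew_unit i j \<in> so_alg"
  proof (rule so_algI)
  fix a b
  show "skew_unit i j $ a $ b \<in> \<real>" by (simp add: skew_unit_def)
  show "skew_unit i j $ b $ a = - skew_unit i j $ a $ b"
    unfolding skew_unit_def vec_lambda_beta minus_diff_eq by (simp only: conj_commute)
qed

lemma sym_unit_sym_alg: "sym_unit i j \<in> sym_alg"
  proof -
  have "sym_unit i j $ a $ b \<in> \<real>" for a b by (simp add: sym_unit_def)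
  moreover have "sym_unit i j $ b $ a = sym_unit i j $ a $ b" for a b
    unfolding sym_unit_def vec_lambda_beta by (simp only: conj_commute add.commute)
  ultimately show ?thesis unfolding sym_alg_def by blast
qed

lemma trace_inner_sum: "trace_inner A B = (\<Sum>i\<in>UNIV. \<Sum>j\<in>UNIV. A $ i $ j * cnj (B $ i $ j))"
  by (simp add: trace_inner_def trace_def matrix_matrix_mult_def conj_transpose_def)

lemma trace_inner_skew_unit: "trace_inner A (skew_unit i j) = A $ i $ j - A $ j $ i"
proof -
  have "A $ a $ b * cnj (skew_unit i j $ a $ b) =
      (if a = i then if b = j then A $ a $ b else 0 else 0)
      - (if a = j then if b = i then A $ a $ b else 0 else 0)" for a b
    unfolding skew_unit_def vec_lambda_beta
    by (cases "a = i"; cases "b = j"; cases "a = j"; cases "b = i"; simp only: if_True if_False) auto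
  moreover have "(\<Sum>b\<in>UNIV. if a = i then if b = j then A $ a $ b else 0 else 0) =
      (if a = i then A $ a $ j else 0)" for a i j
    by (cases "a = i") simp_all
  ultimately show ?thesis
    unfolding trace_inner_sum by (simp add: sum_subtractf)
qed

text \<open>Pairing with the skew matrix units tests symmetry, and a symmetric skew-Hermitian matrix
  has purely imaginary entries. Conversely, exchanging the two summation indices turns the pairing
  of a symmetric with a skew matrix into its own negative.\<close>

lemma so_perp_iff:
  fixes A :: "complex^'n^'n"
  shows "A \<in> so_perp \<longleftrightarrow> (\<forall>i j. Re (A $ i $ j) = 0 \<and> A $ j $ i = A $ i $ j)"
proof
  assume A: "A \<in> so_perp"
  have sym: "A $ j $ i = A $ i $ j" for i j
  proof -
    have "trace_inner A (skew_unit i j) = 0"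
      using A skew_unit_so_alg unfolding so_perp_def by blast
    then show ?thesis by (simp add: trace_inner_skew_unit)
  qed
  have "cnj (A $ j $ i) = - A $ i $ j" for i j
  proof -
    have "conj_transpose A = - A" using A by (simp add: so_perp_def u_alg_def)
    from arg_cong[OF this, of "\<lambda>M. M $ i $ j"] show ?thesis by (simp add: conj_transpose_def)
  qed
  from this[THEN arg_cong[of _ _ Re]] have "Re (A $ i $ j) = 0" for i j
    using arg_cong[OF sym[of j i], of Re] by (metis cnj.sel(1) uminus_complex.sel(1) equal_neg_zero)
  then show "\<forall>i j. Re (A $ i $ j) = 0 \<and> A $ j $ i = A $ i $ j"
    using sym by blast
next
  assume A: "\<forall>i j. Re (A $ i $ j) = 0 \<and> A $ j $ i = A $ i $ j"
  have "cnj (A $ j $ i) = - A $ i $ j" for i j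
  proof -
    have "A $ j $ i = A $ i $ j" "Re (A $ i $ j) = 0" using A by blast+
    then show ?thesis by (simp add: complex_eq_iff)
  qed
  then have "A \<in> u_alg"
    by (simp add: u_alg_def conj_transpose_def vec_eq_iff)
  moreover have "trace_inner A B = 0" if B: "B \<in> so_alg" for B
  proof -
    have "trace_inner A B = (\<Sum>i\<in>UNIV. \<Sum>j\<in>UNIV. A $ j $ i * cnj (B $ j $ i))"
      unfolding trace_inner_sum by (rule sum.swap)
    also have "\<dots> = - trace_inner A B"
      unfolding trace_inner_sum sum_negf[symmetric]
    proof (intro sum.cong refl)
      fix i j
      have "A $ j $ i = A $ i $ j" using A by blast
      then show "A $ j $ i * cnj (B $ j $ i) = - (A $ i $ j * cnj (B $ i $ j))"
        using so_alg_skew[OF B, of j i] by simp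
    qed
    finally show ?thesis by simp
  qed
  ultimately show "A \<in> so_perp" by (simp add: so_perp_def)
qed

text \<open>The members of \<open>so_perp\<close> are symmetric with purely imaginary entries; the
  factor \<open>\<i>\<close> makes the entries real.\<close>

lemma S_mats_eq: "S_mats = sym_alg"
proof (intro set_eqI iffI)
  fix A :: "complex^'n^'n"
  assume "A \<in> S_mats"
  then obtain B where B: "B \<in> so_perp" "A = cscale \<i> B" unfolding S_mats_def by blast
  have "A $ i $ j \<in> \<real> \<and> A $ j $ i = A $ i $ j" for i j
  proof -
    have "B $ j $ i = B $ i $ j" "Re (B $ i $ j) = 0" using B(1) unfolding so_perp_iff by blast+
    then show ?thesis by (simp add: B(2) cscale_def complex_is_Real_iff)
  qed
  then show "A \<in> sym_alg" by (simp only: sym_alg_def mem_Collect_eq) blast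
next
  fix A :: "complex^'n^'n"
  assume A: "A \<in> sym_alg"
  have "A = cscale \<i> (cscale (- \<i>) A)" by (simp add: cscale_def vec_eq_iff)
  moreover have "cscale (- \<i>) A \<in> so_perp"
    unfolding so_perp_iff
  proof (intro allI)
    fix i j
    have "A $ j $ i = A $ i $ j" "A $ i $ j \<in> \<real>" using A unfolding sym_alg_def by blast+
    then show "Re (cscale (- \<i>) A $ i $ j) = 0 \<and> cscale (- \<i>) A $ j $ i = cscale (- \<i>) A $ i $ j"
      by (simp add: cscale_def complex_is_Real_iff)
  qed
  ultimately show "A \<in> S_mats" unfolding S_mats_def by blast
qed

section \<open>Scalars and signs in Kronecker products\<close>

lemma kronecker_cscale:
  "kronecker (cscale c A) B = cscale c (kronecker A B)"
  "kronecker A (cscale c B) = cscale c (kronecker A B)"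
  by (simp_all add: kronecker_def cscale_def vec_eq_iff)

lemma cscale_cscale: "cscale c (cscale d A) = cscale (c * d) A"
  by (simp add: cscale_def vec_eq_iff mult.assoc)

lemma cscale_minus_one: "cscale (-1) A = - A"
  by (simp add: cscale_def vec_eq_iff)

lemma cscale_uminus: "cscale c (- A) = - cscale c A"
  by (simp add: cscale_def vec_eq_iff)

lemma kronecker_uminus: "kronecker (- A) B = - kronecker A B" "kronecker A (- B) = - kronecker A B"
  by (simp_all add: kronecker_def vec_eq_iff)

lemma so_alg_uminus: "A \<in> so_alg \<Longrightarrow> - A \<in> so_alg"
  using subspace_neg[OF subspace_so_alg] .

text \<open>The factors \<open>\<i>\<close> of \<open>i_tensor\<close> and of \<open>\<sigma>\<close> cancel up to a sign, which the real skew-symmetric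
  matrix absorbs.\<close>

lemma i_tensor_sigma:
  assumes P: "\<And>A c. c \<noteq> 0 \<Longrightarrow> P (cscale c A) = P A"
  shows "i_tensor {A \<in> sigma_mats. P A} T = {kronecker K S | K S. K \<in> so_alg \<and> P K \<and> S \<in> T}"
proof (intro set_eqI iffI)
  fix X assume "X \<in> i_tensor {A \<in> sigma_mats. P A} T"
  then obtain K S where X: "X = kronecker (cscale \<i> (cscale \<i> K)) S"
    and K: "K \<in> so_alg" "P (cscale \<i> K)" and S: "S \<in> T"
    unfolding i_tensor_def sigma_mats_def by blast
  have "X = kronecker (- K) S" by (simp add: X cscale_cscale cscale_minus_one)
  moreover have "P (- K)" using K(2) P[of "-1" K] P[of "\<i>" K] by (simp add: cscale_minus_one)
  ultimately show "X \<in> {kronecker K S | K S. K \<in> so_alg \<and> P K \<and> S \<in> T}"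
    using so_alg_uminus[OF K(1)] S by blast
next
  fix X assume "X \<in> {kronecker K S | K S. K \<in> so_alg \<and> P K \<and> S \<in> T}"
  then obtain K S where X: "X = kronecker K S" and K: "K \<in> so_alg" "P K" and S: "S \<in> T" by blast
  have "X = kronecker (cscale \<i> (cscale \<i> (- K))) S"
    by (simp add: X cscale_cscale cscale_minus_one)
  moreover have "P (cscale \<i> (- K))"
    using K(2) P[of "-1" K] P[of "\<i>" "- K"] by (simp add: cscale_minus_one)
  ultimately show "X \<in> i_tensor {A \<in> sigma_mats. P A} T"
    unfolding i_tensor_def sigma_mats_def using so_alg_uminus[OF K(1)] S by blast
qed

lemma i_tensor_S_sigma:
  assumes P: "\<And>A c. c \<noteq> 0 \<Longrightarrow> P (cscale c A) = P A"
  shows "i_tensor T {A \<in> sigma_mats. P A} = {kronecker S K | S K. S \<in> T \<and> K \<in> so_alg \<and> P K}"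
proof (intro set_eqI iffI)
  fix X assume "X \<in> i_tensor T {A \<in> sigma_mats. P A}"
  then obtain K S where X: "X = kronecker (cscale \<i> S) (cscale \<i> K)"
    and K: "K \<in> so_alg" "P (cscale \<i> K)" and S: "S \<in> T"
    unfolding i_tensor_def sigma_mats_def by blast
  have "X = kronecker S (- K)"
    by (simp add: X cscale_cscale cscale_minus_one cscale_uminus kronecker_cscale kronecker_uminus)
  moreover have "P (- K)" using K(2) P[of "-1" K] P[of "\<i>" K] by (simp add: cscale_minus_one)
  ultimately show "X \<in> {kronecker S K | S K. S \<in> T \<and> K \<in> so_alg \<and> P K}"
    using so_alg_uminus[OF K(1)] S by blast
next
  fix X assume "X \<in> {kronecker S K | S K. S \<in> T \<and> K \<in> so_alg \<and> P K}"
  then obtain K S where X: "X = kronecker S K" and K: "K \<in> so_alg" "P K" and S: "S \<in> T" by blast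
  have "X = kronecker (cscale \<i> S) (cscale \<i> (- K))"
    by (simp add: X cscale_cscale cscale_minus_one cscale_uminus kronecker_cscale kronecker_uminus)
  moreover have "P (cscale \<i> (- K))"
    using K(2) P[of "-1" K] P[of "\<i>" "- K"] by (simp add: cscale_minus_one)
  ultimately show "X \<in> i_tensor T {A \<in> sigma_mats. P A}"
    unfolding i_tensor_def sigma_mats_def using so_alg_uminus[OF K(1)] S by blast
qed

section \<open>The bipartite algebras as block matrices\<close>

lemma kronecker_component [simp]: "kronecker A B $ (i, k) $ (j, l) = A $ i $ j * B $ k $ l"
  by (simp add: kronecker_def)

lemma sym_alg_real: "A \<in> sym_alg \<Longrightarrow> A $ i $ j \<in> \<real>"
  by (simp add: sym_alg_def)

lemma sym_alg_sym: "A \<in> sym_alg \<Longrightarrow> A $ j $ i = A $ i $ j"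
  by (simp only: sym_alg_def mem_Collect_eq)

lemma kronecker_so_sym:
  assumes "K \<in> so_alg" "S \<in> sym_alg"
  shows "kronecker K S \<in> so_alg"
proof (rule so_algI)
  fix p q :: "'a \<times> 'b"
  obtain i k j l where pq: "p = (i, k)" "q = (j, l)" by (metis surj_pair)
  show "kronecker K S $ p $ q \<in> \<real>"
    unfolding pq by (simp add: so_alg_real[OF assms(1)] sym_alg_real[OF assms(2)])
  show "kronecker K S $ q $ p = - kronecker K S $ p $ q"
    unfolding pq kronecker_component
    using so_alg_skew[OF assms(1), of j i] sym_alg_sym[OF assms(2), of l k] by simp
qed

lemma kronecker_sym_so:
  assumes "S \<in> sym_alg" "K \<in> so_alg"
  shows "kronecker S K \<in> so_alg"
proof (rule so_algI)
  fix p q :: "'a \<times> 'b"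
  obtain i k j l where pq: "p = (i, k)" "q = (j, l)" by (metis surj_pair)
  show "kronecker S K $ p $ q \<in> \<real>"
    unfolding pq by (simp add: so_alg_real[OF assms(2)] sym_alg_real[OF assms(1)])
  show "kronecker S K $ q $ p = - kronecker S K $ p $ q"
    unfolding pq kronecker_component
    using so_alg_skew[OF assms(2), of l k] sym_alg_sym[OF assms(1), of j i] by simp
qed

lemma skew_unit_prod:
  "skew_unit (i, k) (j, l) = (1/2) *\<^sub>R (kronecker (skew_unit i j) (sym_unit k l) +
     kronecker (sym_unit i j) (skew_unit k l))"
proof -
  have "skew_unit (i, k) (j, l) $ (a, c) $ (b, d) =
     (1/2) *\<^sub>R (skew_unit i j $ a $ b * sym_unit k l $ c $ d +
       sym_unit i j $ a $ b * skew_unit k l $ c $ d)" for a b c d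
  proof -
    \<comment> \<open>In terms of the four indicators the claim is twice
      \<open>x * z - y * w\<close> equals \<open>(x - y) * (z + w) + (x + y) * (z - w)\<close>: the
      mixed terms cancel.\<close>
    define x y z w :: complex
      where "x = (if a = i \<and> b = j then 1 else 0)" and "y = (if a = j \<and> b = i then 1 else 0)"
        and "z = (if c = k \<and> d = l then 1 else 0)" and "w = (if c = l \<and> d = k then 1 else 0)"
    have "(if (a, c) = (i, k) \<and> (b, d) = (j, l) then 1 else 0) = x * z"
      "(if (a, c) = (j, l) \<and> (b, d) = (i, k) then 1 else 0) = y * w"
      by (simp_all add: x_def y_def z_def w_def)
    then show ?thesis
      unfolding skew_unit_def sym_unit_def vec_lambda_beta x_def[symmetric] y_def[symmetric]
        z_def[symmetric] w_def[symmetric]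
      by (simp add: scaleR_conv_of_real algebra_simps)
  qed
  then show ?thesis by (simp add: vec_eq_iff)
qed

text \<open>A skew matrix is the sum over all ordered pairs of entry times skew unit, halved because
  each unordered pair occurs twice. Units are required only where the entry is nonzero, so a
  vanishing pattern of \<open>A\<close> restricts the units to be found in \<open>V\<close>.\<close>

lemma so_alg_in_subspace:
  assumes A: "A \<in> so_alg" and V: "subspace V"
    and unit: "\<And>p q. A $ p $ q \<noteq> 0 \<Longrightarrow> skew_unit p q \<in> V"
  shows "A \<in> V"
proof -
  let ?B = "\<Sum>p\<in>UNIV. \<Sum>q\<in>UNIV. (Re (A $ p $ q) / 2) *\<^sub>R skew_unit p q"
  have "?B $ i $ j = A $ i $ j" for i j
  proof -
    have "?B $ i $ j = (\<Sum>p\<in>UNIV. \<Sum>q\<in>UNIV. (if p = i then if q = j then A $ p $ q / 2 else 0 else 0)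
       - (if p = j then if q = i then A $ p $ q / 2 else 0 else 0))"
      unfolding sum_component
    proof (intro sum.cong refl)
      fix p q
      have "complex_of_real (Re (A $ p $ q)) = A $ p $ q" using so_alg_real[OF A] by simp
      then show "((Re (A $ p $ q) / 2) *\<^sub>R skew_unit p q) $ i $ j =
         (if p = i then if q = j then A $ p $ q / 2 else 0 else 0)
         - (if p = j then if q = i then A $ p $ q / 2 else 0 else 0)"
        unfolding skew_unit_def vector_scaleR_component vec_lambda_beta
        by (cases "p = i"; cases "q = j"; cases "p = j"; cases "q = i";
          simp only: if_True if_False) (auto simp: scaleR_conv_of_real)
    qed
    also have "\<dots> = (\<Sum>p\<in>UNIV. (if p = i then A $ p $ j / 2 else 0) - (if p = j then A $ p $ i / 2 else 0))"
    proof (intro sum.cong refl)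
      fix p
      have "(\<Sum>q\<in>UNIV. if p = i then if q = j then A $ p $ q / 2 else 0 else 0) =
        (if p = i then A $ p $ j / 2 else 0)" for i j by (cases "p = i") simp_all
      then show "(\<Sum>q\<in>UNIV. (if p = i then if q = j then A $ p $ q / 2 else 0 else 0)
       - (if p = j then if q = i then A $ p $ q / 2 else 0 else 0)) =
        (if p = i then A $ p $ j / 2 else 0) - (if p = j then A $ p $ i / 2 else 0)"
        by (simp add: sum_subtractf)
    qed
    also have "\<dots> = A $ i $ j / 2 - A $ j $ i / 2"
      by (simp add: sum_subtractf)
    finally show ?thesis using so_alg_skew[OF A, of j i] by simp
  qed
  then have "A = ?B" by (simp add: vec_eq_iff)
  also have "\<dots> \<in> V"
  proof (intro subspace_sum[OF V])
    fix p q
    show "(Re (A $ p $ q) / 2) *\<^sub>R skew_unit p q \<in> V"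
      using unit[of p q] subspace_scale[OF V] subspace_0[OF V] by (cases "A $ p $ q = 0") simp_all
  qed
  finally show ?thesis .
qed

section \<open>Block parity and its behaviour under Kronecker products\<close>

definition so_diag :: "'n::finite set \<Rightarrow> (complex^'n^'n) set" where
  "so_diag W = {A \<in> so_alg. block_diagonal W A}"

definition so_antidiag :: "'n::finite set \<Rightarrow> (complex^'n^'n) set" where
  "so_antidiag W = {A \<in> so_alg. block_antidiagonal W A}"

definition block_prod :: "'a set \<Rightarrow> 'b set \<Rightarrow> ('a \<times> 'b) set" where
  "block_prod U1 U2 = U1 \<times> U2 \<union> (- U1) \<times> (- U2)"

lemma mem_block_prod [simp]: "(i, k) \<in> block_prod U1 U2 \<longleftrightarrow> (i \<in> U1 \<longleftrightarrow> k \<in> U2)"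
  by (auto simp: block_prod_def)

lemma block_diagonal_cscale [simp]:
  "c \<noteq> 0 \<Longrightarrow> block_diagonal U (cscale c A) = block_diagonal U A"
  "c \<noteq> 0 \<Longrightarrow> block_antidiagonal U (cscale c A) = block_antidiagonal U A"
  by (simp_all add: block_diagonal_def block_antidiagonal_def cscale_def)

lemma block_kronecker:
  assumes "block_diagonal U1 A"
  shows "block_diagonal U2 B \<Longrightarrow> block_diagonal (block_prod U1 U2) (kronecker A B)"
    and "block_antidiagonal U2 B \<Longrightarrow> block_antidiagonal (block_prod U1 U2) (kronecker A B)"
  using assms by (fastforce simp: block_diagonal_def block_antidiagonal_def)+

lemma block_kronecker':
  assumes "block_antidiagonal U1 A"
  shows "block_diagonal U2 B \<Longrightarrow> block_antidiagonal (block_prod U1 U2) (kronecker A B)"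
    and "block_antidiagonal U2 B \<Longrightarrow> block_diagonal (block_prod U1 U2) (kronecker A B)"
  using assms by (fastforce simp: block_diagonal_def block_antidiagonal_def)+

lemma block_units:
  "(i \<in> U) = (j \<in> U) \<Longrightarrow> block_diagonal U (skew_unit i j)"
  "(i \<in> U) = (j \<in> U) \<Longrightarrow> block_diagonal U (sym_unit i j)"
  "(i \<in> U) \<noteq> (j \<in> U) \<Longrightarrow> block_antidiagonal U (skew_unit i j)"
  "(i \<in> U) \<noteq> (j \<in> U) \<Longrightarrow> block_antidiagonal U (sym_unit i j)"
  by (auto simp: block_diagonal_def block_antidiagonal_def skew_unit_def sym_unit_def)

lemma subspace_block:
  "subspace (so_diag W)" "subspace (so_antidiag W)"
  using subspace_so_alg unfolding subspace_def so_diag_def so_antidiag_def block_diagonal_def block_antidiagonal_def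
  by auto

lemma i_tensor_blocks:
  "i_tensor (sigma_D U1) (S_D U2) =
    {kronecker K S | K S. K \<in> so_alg \<and> block_diagonal U1 K \<and> S \<in> sym_alg \<and> block_diagonal U2 S}"
  "i_tensor (sigma_D U1) (S_A U2) =
    {kronecker K S | K S. K \<in> so_alg \<and> block_diagonal U1 K \<and> S \<in> sym_alg \<and> block_antidiagonal U2 S}"
  "i_tensor (sigma_A U1) (S_D U2) =
    {kronecker K S | K S. K \<in> so_alg \<and> block_antidiagonal U1 K \<and> S \<in> sym_alg \<and> block_diagonal U2 S}"
  "i_tensor (sigma_A U1) (S_A U2) =
    {kronecker K S | K S. K \<in> so_alg \<and> block_antidiagonal U1 K \<and> S \<in> sym_alg \<and> block_antidiagonal U2 S}"
  "i_tensor (S_D U1) (sigma_D U2) =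
    {kronecker S K | S K. S \<in> sym_alg \<and> block_diagonal U1 S \<and> K \<in> so_alg \<and> block_diagonal U2 K}"
  "i_tensor (S_D U1) (sigma_A U2) =
    {kronecker S K | S K. S \<in> sym_alg \<and> block_diagonal U1 S \<and> K \<in> so_alg \<and> block_antidiagonal U2 K}"
  "i_tensor (S_A U1) (sigma_D U2) =
    {kronecker S K | S K. S \<in> sym_alg \<and> block_antidiagonal U1 S \<and> K \<in> so_alg \<and> block_diagonal U2 K}"
  "i_tensor (S_A U1) (sigma_A U2) =
    {kronecker S K | S K. S \<in> sym_alg \<and> block_antidiagonal U1 S \<and> K \<in> so_alg \<and> block_antidiagonal U2 K}"
  unfolding sigma_D_def sigma_A_def S_D_def S_A_def S_mats_eq
  by (subst i_tensor_sigma i_tensor_S_sigma; simp add: conj_assoc)+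

lemma frak_k_eq: "(frak_k :: (complex^('a::finite \<times> 'b::finite)^('a \<times> 'b)) set) = so_alg"
proof
  have gens: "(i_tensor sigma_mats S_mats :: (complex^('a \<times> 'b)^('a \<times> 'b)) set) = {kronecker K S | K S. K \<in> so_alg \<and> S \<in> sym_alg}"
    "(i_tensor S_mats sigma_mats :: (complex^('a \<times> 'b)^('a \<times> 'b)) set) = {kronecker S K | S K. S \<in> sym_alg \<and> K \<in> so_alg}"
    using i_tensor_sigma[of "\<lambda>_. True" S_mats] i_tensor_S_sigma[of "\<lambda>_. True" S_mats]
    by (simp_all add: S_mats_eq)
  show "(frak_k :: (complex^('a \<times> 'b)^('a \<times> 'b)) set) \<subseteq> so_alg"
    unfolding frak_k_def gens
    by (rule span_minimal[OF _ subspace_so_alg]) (auto intro: kronecker_so_sym kronecker_sym_so)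
  show "so_alg \<subseteq> (frak_k :: (complex^('a \<times> 'b)^('a \<times> 'b)) set)"
  proof
    fix A :: "complex^('a \<times> 'b)^('a \<times> 'b)"
    assume A: "A \<in> so_alg"
    show "A \<in> frak_k"
      unfolding frak_k_def gens
    proof (rule so_alg_in_subspace[OF A subspace_span])
      fix p q :: "'a \<times> 'b"
      obtain i k j l where pq: "p = (i, k)" "q = (j, l)" by (metis surj_pair)
      show "skew_unit p q \<in> span ({kronecker K S | K S. K \<in> so_alg \<and> S \<in> sym_alg} \<union>
          {kronecker S K | S K. S \<in> sym_alg \<and> K \<in> so_alg})"
        unfolding pq skew_unit_prod
        by (intro span_scale span_add span_base)
          (use skew_unit_so_alg sym_unit_sym_alg in blast)+
    qed
  qed
qed

lemma frak_k'_eq: "frak_k' U1 U2 = so_diag (block_prod U1 U2)"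
proof
  show "frak_k' U1 U2 \<subseteq> so_diag (block_prod U1 U2)"
    unfolding frak_k'_def i_tensor_blocks
    by (rule span_minimal[OF _ subspace_block(1)])
      (auto simp: so_diag_def intro: kronecker_so_sym kronecker_sym_so block_kronecker block_kronecker')
  show "so_diag (block_prod U1 U2) \<subseteq> frak_k' U1 U2"
  proof
    fix A assume A: "A \<in> so_diag (block_prod U1 U2)"
    then have so: "A \<in> so_alg" by (simp add: so_diag_def)
    show "A \<in> frak_k' U1 U2"
      unfolding frak_k'_def
    proof (rule so_alg_in_subspace[OF so subspace_span])
      fix p q :: "'a \<times> 'b"
      assume nz: "A $ p $ q \<noteq> 0"
      obtain i k j l where pq: "p = (i, k)" "q = (j, l)" by (metis surj_pair)
      \<comment> \<open>A nonzero entry joins two indices of the same product block, so the two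
        factors have equal parity. That common parity decides whether both summands of the skew unit
        are diagonal with diagonal or antidiagonal with antidiagonal.\<close>
      have "((i \<in> U1) = (j \<in> U1)) = ((k \<in> U2) = (l \<in> U2))"
        using A nz by (auto simp: so_diag_def block_diagonal_def pq)
      then show "skew_unit p q \<in> span
         (i_tensor (sigma_D U1) (S_D U2) \<union> i_tensor (S_D U1) (sigma_D U2) \<union>
          i_tensor (sigma_A U1) (S_A U2) \<union> i_tensor (S_A U1) (sigma_A U2))"
        unfolding pq skew_unit_prod i_tensor_blocks
        by (intro span_scale span_add span_base; cases "(i \<in> U1) = (j \<in> U1)")
          (use skew_unit_so_alg sym_unit_sym_alg block_units[of i U1 j] block_units[of k U2 l] in blast)+
    qed
  qed
qed

lemma frak_p'_eq: "frak_p' U1 U2 = so_antidiag (block_prod U1 U2)"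
proof
  show "frak_p' U1 U2 \<subseteq> so_antidiag (block_prod U1 U2)"
    unfolding frak_p'_def i_tensor_blocks
    by (rule span_minimal[OF _ subspace_block(2)])
      (auto simp: so_antidiag_def intro: kronecker_so_sym kronecker_sym_so block_kronecker block_kronecker')
  show "so_antidiag (block_prod U1 U2) \<subseteq> frak_p' U1 U2"
  proof
    fix A assume A: "A \<in> so_antidiag (block_prod U1 U2)"
    then have so: "A \<in> so_alg" by (simp add: so_antidiag_def)
    show "A \<in> frak_p' U1 U2"
      unfolding frak_p'_def
    proof (rule so_alg_in_subspace[OF so subspace_span])
      fix p q :: "'a \<times> 'b"
      assume nz: "A $ p $ q \<noteq> 0"
      obtain i k j l where pq: "p = (i, k)" "q = (j, l)" by (metis surj_pair)
      have "((i \<in> U1) = (j \<in> U1)) \<noteq> ((k \<in> U2) = (l \<in> U2))"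
        using A nz by (auto simp: so_antidiag_def block_antidiagonal_def pq)
      then show "skew_unit p q \<in> span
         (i_tensor (sigma_A U1) (S_D U2) \<union> i_tensor (sigma_D U1) (S_A U2) \<union>
          i_tensor (S_D U1) (sigma_A U2) \<union> i_tensor (S_A U1) (sigma_D U2))"
        unfolding pq skew_unit_prod i_tensor_blocks
        by (intro span_scale span_add span_base; cases "(i \<in> U1) = (j \<in> U1)")
          (use skew_unit_so_alg sym_unit_sym_alg block_units[of i U1 j] block_units[of k U2 l] in blast)+
    qed
  qed
qed

lemma card_block_prod:
  fixes U1 :: "'a::finite set" and U2 :: "'b::finite set"
  shows "card (block_prod U1 U2) =
    card U1 * card U2 + (CARD('a) - card U1) * (CARD('b) - card U2)"
  unfolding block_prod_def
  by (subst card_Un_disjoint) (auto simp: card_cartesian_product Compl_eq_Diff_UNIV card_Diff_subset)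

section \<open>Semisimplicity\<close>

lemma commutator_component:
  "commutator A B $ i $ j = (\<Sum>k\<in>UNIV. A $ i $ k * B $ k $ j - B $ i $ k * A $ k $ j)"
  by (simp add: commutator_def matrix_matrix_mult_def sum_subtractf)

text \<open>Linearity makes kernels and preimages of subspaces under \<open>commutator A\<close>
  subspaces, so bracket conditions on a span need checking on generators only.\<close>

lemma linear_commutator: "linear (commutator A)"
proof (rule linearI)
  fix B C :: "complex^'a^'a" and c :: real
  have "commutator A (B + C) $ i $ j = (commutator A B + commutator A C) $ i $ j" for i j
    unfolding vector_add_component commutator_component sum.distrib[symmetric]
    by (intro sum.cong refl) (simp add: algebra_simps)
  then show "commutator A (B + C) = commutator A B + commutator A C" by (simp add: vec_eq_iff)
  have "commutator A (c *\<^sub>R B) $ i $ j = (c *\<^sub>R commutator A B) $ i $ j" for i j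
    unfolding vector_scaleR_component commutator_component scaleR_sum_right
    by (intro sum.cong refl) (simp add: algebra_simps)
  then show "commutator A (c *\<^sub>R B) = c *\<^sub>R commutator A B" by (simp add: vec_eq_iff)
qed

lemma matrix_sub_ldistrib: "(A::'a::ring_1^'n^'m) ** (B - C) = A ** B - A ** C"
  by (simp add: matrix_matrix_mult_def vec_eq_iff sum_subtractf right_diff_distrib)

lemma matrix_sub_rdistrib: "((B::'a::ring_1^'n^'m) - C) ** A = B ** A - C ** A"
  by (simp add: matrix_matrix_mult_def vec_eq_iff sum_subtractf left_diff_distrib)

lemma commutator_jacobi:
  "commutator A (commutator X Y) = commutator (commutator A X) Y + commutator X (commutator A Y)"
  by (simp add: commutator_def matrix_sub_ldistrib matrix_sub_rdistrib matrix_mul_assoc)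

lemma commutator_so_alg:
  assumes A: "A \<in> so_alg" and B: "B \<in> so_alg"
  shows "commutator A B \<in> so_alg"
proof (rule so_algI)
  fix i j
  show "commutator A B $ i $ j \<in> \<real>"
    unfolding commutator_component
    by (intro sum_in_Reals Reals_diff Reals_mult so_alg_real[OF A] so_alg_real[OF B])
  have "A $ j $ k * B $ k $ i - B $ j $ k * A $ k $ i = - (A $ i $ k * B $ k $ j - B $ i $ k * A $ k $ j)" for k
    unfolding so_alg_skew[OF A, of j k] so_alg_skew[OF A, of k i]
      so_alg_skew[OF B, of j k] so_alg_skew[OF B, of k i] by (simp add: algebra_simps)
  then have "(\<Sum>k\<in>UNIV. A $ j $ k * B $ k $ i - B $ j $ k * A $ k $ i) =
     (\<Sum>k\<in>UNIV. - (A $ i $ k * B $ k $ j - B $ i $ k * A $ k $ j))"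
    by (rule sum.cong[OF refl])
  then show "commutator A B $ j $ i = - commutator A B $ i $ j"
    unfolding commutator_component by (simp only: sum_negf)
qed

lemma lie_subalgebra_so_alg: "lie_subalgebra so_alg"
  unfolding lie_subalgebra_def using subspace_so_alg commutator_so_alg by blast

lemma commutator_in_derived_algebra:
  "X \<in> I \<Longrightarrow> Y \<in> I \<Longrightarrow> commutator X Y \<in> derived_algebra I"
  unfolding derived_algebra_def by (rule span_base) blast

text \<open>By the Jacobi identity \<open>commutator A\<close> acts as a derivation on brackets of
  elements of \<open>I\<close>, and both resulting terms are again such brackets. This keeps every
  member of the derived series of an ideal an ideal of the whole algebra.\<close>

lemma lie_ideal_derived_algebra:
  assumes I: "lie_ideal I L" and L: "lie_subalgebra L"
  shows "lie_ideal (derived_algebra I) L"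
proof -
  have "{commutator A B |A B. A \<in> I \<and> B \<in> I} \<subseteq> L"
    using assms unfolding lie_ideal_def lie_subalgebra_def by blast
  moreover have "subspace L" using L unfolding lie_subalgebra_def by blast
  ultimately have sub: "derived_algebra I \<subseteq> L"
    unfolding derived_algebra_def by (rule span_minimal)
  have sD: "subspace (derived_algebra I)" unfolding derived_algebra_def by (rule subspace_span)
  have "commutator A B \<in> derived_algebra I" if A: "A \<in> L" and B: "B \<in> derived_algebra I" for A B
  proof -
    let ?V = "commutator A -` derived_algebra I"
    have "subspace ?V" by (rule linear_subspace_vimage[OF linear_commutator sD])
    moreover have "commutator A (commutator X Y) \<in> derived_algebra I" if "X \<in> I" "Y \<in> I" for X Y
    proof -
      have "commutator A X \<in> I" "commutator A Y \<in> I"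
        using I A that unfolding lie_ideal_def by blast+
      then show ?thesis
        using that by (subst commutator_jacobi) (intro subspace_add[OF sD] commutator_in_derived_algebra)
    qed
    then have "{commutator A B |A B. A \<in> I \<and> B \<in> I} \<subseteq> ?V"
      by (intro subsetI vimageI2) (elim CollectE exE conjE, simp only:)
    ultimately have "span {commutator A B |A B. A \<in> I \<and> B \<in> I} \<subseteq> ?V"
      by (intro span_minimal)
    moreover have "B \<in> span {commutator A B |A B. A \<in> I \<and> B \<in> I}"
      using B unfolding derived_algebra_def .
    ultimately show ?thesis by (rule subsetD[THEN vimageD])
  qed
  then show ?thesis
    unfolding lie_ideal_def using sub sD by blast
qed

text \<open>For a real skew-symmetric matrix the trace of the square is minus the sum of the squares
  of the entries, so the trace form is negative definite.\<close>

lemma so_alg_trace_square_eq_0: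
  assumes A: "A \<in> so_alg" and tr: "trace (A ** A) = 0"
  shows "A = 0"
proof -
  have *: "A $ i $ k * A $ k $ i = - complex_of_real ((Re (A $ i $ k))\<^sup>2)" for i k
  proof -
    have "A $ i $ k = complex_of_real (Re (A $ i $ k))" using so_alg_real[OF A] by simp
    then have "A $ i $ k * A $ i $ k = complex_of_real ((Re (A $ i $ k))\<^sup>2)"
      by (metis of_real_mult power2_eq_square)
    then show ?thesis unfolding so_alg_skew[OF A, of k i] by simp
  qed
  have "trace (A ** A) = - complex_of_real (\<Sum>i\<in>UNIV. \<Sum>k\<in>UNIV. (Re (A $ i $ k))\<^sup>2)"
    by (simp add: trace_def matrix_matrix_mult_def * sum_negf)
  then have "(\<Sum>i\<in>UNIV. \<Sum>k\<in>UNIV. (Re (A $ i $ k))\<^sup>2) = 0"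
    using tr by (metis neg_equal_0_iff_equal of_real_eq_0_iff)
  then have "Re (A $ i $ k) = 0" for i k
    by (simp add: sum_nonneg_eq_0_iff sum_nonneg)
  then have "A $ i $ k = 0" for i k
    using so_alg_real[OF A, of i k] by (metis Reals_cases Re_complex_of_real of_real_0)
  then show ?thesis by (simp add: vec_eq_iff)
qed

text \<open>The hypothesis says that \<open>C = commutator X Y\<close> commutes with
  \<open>X\<close>. Cyclicity of the trace then moves \<open>X\<close> around, so
  \<open>C ** X ** Y\<close> and \<open>C ** Y ** X\<close> have equal trace, and their difference
  is the square of \<open>C\<close>.\<close>

lemma trace_commutator_square:
  assumes "commutator (commutator X Y) X = 0"
  shows "trace (commutator X Y ** commutator X Y) = 0"
proof -
  let ?C = "commutator X Y"
  have "?C ** X = X ** ?C" using assms by (simp add: commutator_def)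
  then have "?C ** (X ** Y) = X ** (?C ** Y)" by (metis matrix_mul_assoc)
  then have "trace (?C ** (X ** Y)) = trace ((?C ** Y) ** X)"
    by (metis trace_mul_sym)
  then have "trace (?C ** (X ** Y)) = trace (?C ** (Y ** X))" by (simp add: matrix_mul_assoc)
  then have "trace (?C ** (X ** Y - Y ** X)) = 0"
    by (simp add: matrix_sub_ldistrib trace_sub)
  then show ?thesis by (simp add: commutator_def)
qed

text \<open>For distinct \<open>a\<close>, \<open>b\<close> a third index \<open>c\<close> isolates
  the entry: the bracket of \<open>X\<close> with \<open>skew_unit b c\<close> has
  \<open>X $ a $ b\<close> at position \<open>(a, c)\<close>. This is where three indices are used,
  the algebra for two indices being abelian.\<close>

lemma so_alg_center:
  fixes X :: "complex^'n^'n"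
  assumes card: "CARD('n) \<ge> 3" and comm: "\<And>Y. Y \<in> so_alg \<Longrightarrow> commutator X Y = 0"
    and X: "X \<in> so_alg"
  shows "X = 0"
proof -
  have "X $ a $ b = 0" for a b
  proof (cases "a = b")
    case True
    then show ?thesis using so_alg_skew[OF X, of a b] by simp
  next
    case False
    have "card {a, b} < CARD('n)" using card False by simp
    then obtain c where c: "c \<notin> {a, b}"
      by (metis UNIV_eq_I nat_neq_iff)
    let ?Y = "skew_unit b c"
    have Ya: "?Y $ a $ k = 0" for k using c False by (auto simp: skew_unit_def)
    have Yc: "?Y $ k $ c = (if k = b then 1 else 0)" for k using c by (simp add: skew_unit_def)
    have "commutator X ?Y $ a $ c = (\<Sum>k\<in>UNIV. if k = b then X $ a $ k else 0)"
      unfolding commutator_component Ya Yc by (intro sum.cong) auto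
    then show ?thesis using comm[OF skew_unit_so_alg, of b c] by simp
  qed
  then show ?thesis by (simp add: vec_eq_iff)
qed

text \<open>For \<open>X\<close> in an abelian ideal and any \<open>Y\<close>, invariance of the trace form makes \<open>[X,Y]\<close> a
  null vector, so that \<open>X\<close> is central.\<close>

lemma so_alg_abelian_ideal:
  fixes I :: "(complex^'n^'n) set"
  assumes card: "CARD('n) \<ge> 3" and I: "lie_ideal I so_alg"
    and ab: "\<And>X Y. X \<in> I \<Longrightarrow> Y \<in> I \<Longrightarrow> commutator X Y = 0"
  shows "I \<subseteq> {0}"
proof
  fix X assume X: "X \<in> I"
  have Xso: "X \<in> so_alg" using X I by (auto simp: lie_ideal_def)
  have "commutator X Y = 0" if Y: "Y \<in> so_alg" for Y
  proof -
    have "commutator Y X \<in> I" using I X Y by (simp add: lie_ideal_def)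
    moreover have anti: "commutator X Y = - commutator Y X" by (simp add: commutator_def)
    ultimately have "commutator X Y \<in> I"
      using I by (simp add: lie_ideal_def subspace_neg)
    then have "trace (commutator X Y ** commutator X Y) = 0"
      by (intro trace_commutator_square ab X)
    then show ?thesis by (rule so_alg_trace_square_eq_0[OF commutator_so_alg[OF Xso Y]])
  qed
  then show "X \<in> {0}" using so_alg_center[OF card _ Xso] by simp
qed

lemma semisimple_so_alg:
  assumes "CARD('n) \<ge> 3"
  shows "semisimple_alg (so_alg :: (complex^'n^'n) set)"
  unfolding semisimple_alg_def
proof (intro conjI allI impI lie_subalgebra_so_alg)
  fix I :: "(complex^'n^'n) set"
  assume I: "lie_ideal I so_alg \<and> solvable_alg I"
  have ideal: "lie_ideal ((derived_algebra ^^ k) I) so_alg" for k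
    by (induction k) (use I in \<open>auto intro: lie_ideal_derived_algebra lie_subalgebra_so_alg\<close>)
  have "I = {0}" if "(derived_algebra ^^ k) I = {0}" for k
    using that
  proof (induction k)
    case (Suc k)
    \<comment> \<open>The series is climbed from its zero term upwards: a member whose derived
      algebra vanishes is an abelian ideal, hence zero itself, and the index drops by one.\<close>
    let ?J = "(derived_algebra ^^ k) I"
    have "commutator X Y = 0" if "X \<in> ?J" "Y \<in> ?J" for X Y
    proof -
      have "commutator X Y \<in> derived_algebra ?J"
        using that by (rule commutator_in_derived_algebra)
      then show ?thesis using Suc.prems by simp
    qed
    then have "?J \<subseteq> {0}" by (rule so_alg_abelian_ideal[OF assms ideal])
    moreover have "0 \<in> ?J" using ideal[of k] by (simp add: lie_ideal_def subspace_0)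
    ultimately show ?case using Suc.IH by blast
  qed simp
  then show "I = {0}" using I unfolding solvable_alg_def by blast
qed

section \<open>The block decomposition is a Cartan decomposition\<close>

text \<open>The bracket inclusions are a parity count. In \<open>X $ i $ k * Y $ k $ j\<close> a
  nonzero factor stays in the block or changes it according to its type, so the types of
  \<open>X\<close> and \<open>Y\<close> decide whether \<open>i\<close> and \<open>j\<close> can lie
  in the same block.\<close>

lemma cartan_decomposition_so_alg:
  fixes W :: "'n::finite set"
  assumes "CARD('n) \<ge> 3"
  shows "cartan_decomposition so_alg (so_diag W) (so_antidiag W)"
proof -
  have split: "\<exists>X Y. A = X + Y \<and> X \<in> so_diag W \<and> Y \<in> so_antidiag W"
    if A: "A \<in> so_alg" for A :: "complex^'n^'n"
  proof -
    define X where "X = (\<chi> i j. if (i \<in> W) = (j \<in> W) then A $ i $ j else 0)"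
    define Y where "Y = (\<chi> i j. if (i \<in> W) = (j \<in> W) then 0 else A $ i $ j)"
    have "A = X + Y" by (simp add: X_def Y_def vec_eq_iff)
    moreover have "X \<in> so_alg"
    proof (rule so_algI)
      fix i j
      show "X $ i $ j \<in> \<real>" using so_alg_real[OF A, of i j] by (simp add: X_def)
      show "X $ j $ i = - X $ i $ j"
        unfolding X_def vec_lambda_beta so_alg_skew[OF A, of j i]
        by (cases "i \<in> W"; cases "j \<in> W") simp_all
    qed
    moreover have "Y \<in> so_alg"
    proof (rule so_algI)
      fix i j
      show "Y $ i $ j \<in> \<real>" using so_alg_real[OF A, of i j] by (simp add: Y_def)
      show "Y $ j $ i = - Y $ i $ j"
        unfolding Y_def vec_lambda_beta so_alg_skew[OF A, of j i]
        by (cases "i \<in> W"; cases "j \<in> W") simp_all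
    qed
    moreover have "block_diagonal W X" "block_antidiagonal W Y"
      by (simp_all add: block_diagonal_def block_antidiagonal_def X_def Y_def)
    ultimately show ?thesis unfolding so_diag_def so_antidiag_def by blast
  qed
  have orth: "trace_inner X Y = 0" if "block_antidiagonal W X" "block_diagonal W Y" for X Y
  proof -
    have "X $ i $ j * cnj (Y $ i $ j) = 0" for i j
      using that by (cases "(i \<in> W) = (j \<in> W)") (auto simp: block_diagonal_def block_antidiagonal_def)
    then show ?thesis unfolding trace_inner_sum by (intro sum.neutral ballI)
  qed
  have perp: "block_antidiagonal W X"
    if X: "X \<in> so_alg" and orth: "\<And>Y. Y \<in> so_diag W \<Longrightarrow> trace_inner X Y = 0" for X
    unfolding block_antidiagonal_def
  proof (intro allI impI)
    fix i j assume "(i \<in> W) = (j \<in> W)"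
    \<comment> \<open>Pairing with this unit gives \<open>X $ i $ j - X $ j $ i\<close>, which is
      \<open>2 * X $ i $ j\<close> by skewness.\<close>
    then have "skew_unit i j \<in> so_diag W"
      using skew_unit_so_alg[of i j] block_units(1) unfolding so_diag_def by blast
    from orth[OF this] show "X $ i $ j = 0"
      using so_alg_skew[OF X, of j i] by (simp add: trace_inner_skew_unit)
  qed
  have 0: "A = 0" if "block_diagonal W A" "block_antidiagonal W A" for A :: "complex^'n^'n"
    using that unfolding block_diagonal_def block_antidiagonal_def vec_eq_iff zero_index by blast
  have comm_diag: "block_diagonal W (commutator X Y)"
    if "block_diagonal W X \<and> block_diagonal W Y \<or> block_antidiagonal W X \<and> block_antidiagonal W Y" for X Y
    unfolding block_diagonal_def commutator_component
  proof (intro allI impI sum.neutral ballI)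
    fix i j k assume "(i \<in> W) \<noteq> (j \<in> W)"
    then show "X $ i $ k * Y $ k $ j - Y $ i $ k * X $ k $ j = 0"
      using that unfolding block_diagonal_def block_antidiagonal_def
      by (cases "k \<in> W"; cases "i \<in> W") auto
  qed
  have comm_anti: "block_antidiagonal W (commutator X Y)"
    if "block_antidiagonal W X" "block_diagonal W Y" for X Y
    unfolding block_antidiagonal_def commutator_component
  proof (intro allI impI sum.neutral ballI)
    fix i j k assume "(i \<in> W) = (j \<in> W)"
    then show "X $ i $ k * Y $ k $ j - Y $ i $ k * X $ k $ j = 0"
      using that unfolding block_diagonal_def block_antidiagonal_def
      by (cases "k \<in> W"; cases "i \<in> W") auto
  qed
  show ?thesis
    unfolding cartan_decomposition_def
  proof (intro conjI semisimple_so_alg[OF assms] subspace_block ballI)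
    show "so_alg = {X + Y |X Y. X \<in> so_diag W \<and> Y \<in> so_antidiag W}"
      using split subspace_add[OF subspace_so_alg] by (auto simp: so_diag_def so_antidiag_def)
    show "so_diag W \<inter> so_antidiag W = {0}"
      using 0 subspace_0[OF subspace_block(1), of W] subspace_0[OF subspace_block(2), of W]
      by (auto simp: so_diag_def so_antidiag_def)
    show "so_antidiag W = {X \<in> so_alg. \<forall>Y\<in>so_diag W. trace_inner X Y = 0}"
      using orth perp by (auto simp: so_antidiag_def so_diag_def)
  qed (auto simp: so_diag_def so_antidiag_def intro: commutator_so_alg comm_diag comm_anti)
qed

section \<open>Type BDI\<close>

text \<open>Since \<open>A\<close> and \<open>B\<close> are read only on their own blocks, the real
  parts of the entries of \<open>X\<close> serve as both in the converse direction.\<close>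

lemma bdi_k_eq: "bdi_k U = so_diag U"
proof
  show "bdi_k U \<subseteq> so_diag U"
  proof
    fix X assume "X \<in> bdi_k U"
    then obtain A B where X: "X = complexify (\<chi> i j. if i \<in> U \<and> j \<in> U then A i j
                         else if i \<notin> U \<and> j \<notin> U then B i j else 0)"
      and A: "\<And>i j. i \<in> U \<Longrightarrow> j \<in> U \<Longrightarrow> A j i = - A i j"
      and B: "\<And>i j. i \<in> - U \<Longrightarrow> j \<in> - U \<Longrightarrow> B j i = - B i j"
      unfolding bdi_k_def by blast
    have "X \<in> so_alg"
    proof (rule so_algI)
      fix i j
      show "X $ i $ j \<in> \<real>" by (simp add: X)
      show "X $ j $ i = - X $ i $ j"
        unfolding X complexify_component vec_lambda_beta
        using A[of i j] B[of i j] by (cases "i \<in> U"; cases "j \<in> U") simp_all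
    qed
    moreover have "block_diagonal U X" by (auto simp: X block_diagonal_def)
    ultimately show "X \<in> so_diag U" by (simp add: so_diag_def)
  qed
  show "so_diag U \<subseteq> bdi_k U"
  proof
    fix X assume X: "X \<in> so_diag U"
    then have so: "X \<in> so_alg" and bd: "block_diagonal U X" by (simp_all add: so_diag_def)
    have R: "complex_of_real (Re (X $ i $ j)) = X $ i $ j" for i j
      using so_alg_real[OF so] by simp
    have "X $ i $ j = complexify (\<chi> i j. if i \<in> U \<and> j \<in> U then Re (X $ i $ j)
                         else if i \<notin> U \<and> j \<notin> U then Re (X $ i $ j) else 0) $ i $ j" for i j
      using bd unfolding block_diagonal_def complexify_component vec_lambda_beta
      by (cases "i \<in> U"; cases "j \<in> U") (simp_all add: R)
    then have *: "X = complexify (\<chi> i j. if i \<in> U \<and> j \<in> U then Re (X $ i $ j)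
                         else if i \<notin> U \<and> j \<notin> U then Re (X $ i $ j) else 0)"
      unfolding vec_eq_iff by blast
    have "Re (X $ j $ i) = - Re (X $ i $ j)" for i j
      unfolding so_alg_skew[OF so, of j i] by simp
    then show "X \<in> bdi_k U" unfolding bdi_k_def
      by (intro CollectI exI conjI ballI) (rule *)
  qed
qed

lemma bdi_p_eq: "bdi_p U = so_antidiag U"
proof
  show "bdi_p U \<subseteq> so_antidiag U"
  proof
    fix X assume "X \<in> bdi_p U"
    then obtain C where X: "X = complexify (\<chi> i j. if i \<in> U \<and> j \<notin> U then C i j
                         else if i \<notin> U \<and> j \<in> U then - C j i else 0)"
      unfolding bdi_p_def by blast
    have "X \<in> so_alg"
    proof (rule so_algI)
      fix i j
      show "X $ i $ j \<in> \<real>" by (simp add: X)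
      show "X $ j $ i = - X $ i $ j"
        unfolding X complexify_component vec_lambda_beta
        by (cases "i \<in> U"; cases "j \<in> U") simp_all
    qed
    moreover have "block_antidiagonal U X" by (auto simp: X block_antidiagonal_def)
    ultimately show "X \<in> so_antidiag U" by (simp add: so_antidiag_def)
  qed
  show "so_antidiag U \<subseteq> bdi_p U"
  proof
    fix X assume X: "X \<in> so_antidiag U"
    then have so: "X \<in> so_alg" and bd: "block_antidiagonal U X" by (simp_all add: so_antidiag_def)
    have R: "complex_of_real (Re (X $ i $ j)) = X $ i $ j" for i j
      using so_alg_real[OF so] by simp
    have "X $ i $ j = complexify (\<chi> i j. if i \<in> U \<and> j \<notin> U then Re (X $ i $ j)
                         else if i \<notin> U \<and> j \<in> U then - Re (X $ j $ i) else 0) $ i $ j" for i j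
      using bd unfolding block_antidiagonal_def complexify_component vec_lambda_beta
      by (cases "i \<in> U"; cases "j \<in> U") (simp_all add: R so_alg_skew[OF so, of i j])
    then have *: "X = complexify (\<chi> i j. if i \<in> U \<and> j \<notin> U then Re (X $ i $ j)
                         else if i \<notin> U \<and> j \<in> U then - Re (X $ j $ i) else 0)"
      unfolding vec_eq_iff by blast
    show "X \<in> bdi_p U" unfolding bdi_p_def
      by (intro CollectI exI conjI TrueI) (rule *)
  qed
qed

section \<open>Conjugation by permutation matrices\<close>

lemma matrix_inv_eqI:
  fixes A B :: "'a::semiring_1^'n^'n"
  assumes "A ** B = mat 1" "B ** A = mat 1"
  shows "matrix_inv A = B"
  unfolding matrix_inv_def
proof (rule some_equality)
  show "A ** B = mat 1 \<and> B ** A = mat 1" using assms by simp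
  fix C assume "A ** C = mat 1 \<and> C ** A = mat 1"
  then show "C = B" by (metis assms(1) matrix_mul_assoc matrix_mul_lid matrix_mul_rid)
qed

lemma complexify_mult: "complexify A ** complexify B = complexify (A ** B)"
  by (simp add: vec_eq_iff matrix_matrix_mult_def)

lemma complexify_mat_1: "complexify (mat 1) = mat 1"
  by (simp add: vec_eq_iff mat_def)

text \<open>The one of row \<open>i\<close> stands in column \<open>p i\<close>. With this
  convention conjugation reads the entry at \<open>(p i, p j)\<close> without inverting
  \<open>p\<close>, and the permutation needed later carries \<open>W\<close> onto
  \<open>U\<close>.\<close>

definition perm_matrix :: "('n \<Rightarrow> 'n) \<Rightarrow> real^'n^'n" where
  "perm_matrix p = (\<chi> i j. if j = p i then 1 else 0)"

lemma orthogonal_perm_matrix: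
  assumes "bij p"
  shows "orthogonal_matrix (perm_matrix p)"
proof -
  have "perm_matrix p ** transpose (perm_matrix p) = mat 1"
    using assms
    by (simp add: perm_matrix_def transpose_def matrix_matrix_mult_def mat_def vec_eq_iff
        if_distrib[of "\<lambda>x. x * _"] bij_is_inj inj_eq cong: if_cong)
  then show ?thesis
    using orthogonal_matrix_transpose[of "perm_matrix p"] by (simp add: orthogonal_matrix)
qed

lemma det_perm_matrix:
  assumes "p permutes (UNIV :: 'n::finite set)"
  shows "det (perm_matrix p) = of_int (sign p)"
proof -
  have "perm_matrix p = (\<chi> i. mat 1 $ p i)"
    by (simp add: perm_matrix_def mat_def vec_eq_iff eq_commute)
  then show ?thesis using det_permute_rows[OF assms, of "mat 1 :: real^'n^'n"] by simp
qed

lemma conjugate_by_perm_matrix: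
  assumes "bij p"
  shows "conjugate_by (perm_matrix p) L = (\<chi> i j. L $ p i $ p j)"
proof -
  let ?P = "perm_matrix p"
  have "?P ** transpose ?P = mat 1" "transpose ?P ** ?P = mat 1"
    using orthogonal_perm_matrix[OF assms] by (simp_all add: orthogonal_matrix_def)
  then have "matrix_inv (complexify ?P) = complexify (transpose ?P)"
    by (intro matrix_inv_eqI) (simp_all add: complexify_mult complexify_mat_1)
  moreover have "complexify ?P ** L = (\<chi> i j. L $ p i $ j)"
    by (simp add: vec_eq_iff matrix_matrix_mult_def perm_matrix_def
        if_distrib[of complex_of_real] if_distrib[of "\<lambda>x. x * _"] cong: if_cong)
  ultimately show ?thesis
    by (simp add: conjugate_by_def vec_eq_iff matrix_matrix_mult_def perm_matrix_def transpose_def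
        if_distrib[of complex_of_real] if_distrib[of "\<lambda>x. _ * x"] cong: if_cong)
qed

lemma conjugate_by_perm_so_alg:
  assumes "bij p"
  shows "conjugate_by (perm_matrix p) L \<in> so_alg \<longleftrightarrow> L \<in> so_alg"
proof
  assume L: "L \<in> so_alg"
  show "conjugate_by (perm_matrix p) L \<in> so_alg"
    unfolding conjugate_by_perm_matrix[OF assms]
    by (rule so_algI; unfold vec_lambda_beta) (rule so_alg_real[OF L] so_alg_skew[OF L])+
next
  assume "conjugate_by (perm_matrix p) L \<in> so_alg"
  then have *: "(\<chi> i j. L $ p i $ p j) \<in> so_alg"
    unfolding conjugate_by_perm_matrix[OF assms] .
  show "L \<in> so_alg"
  proof (rule so_algI)
    fix i j
    obtain a b where ab: "i = p a" "j = p b" using assms by (metis bij_pointE)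
    show "L $ i $ j \<in> \<real>" using so_alg_real[OF *, of a b] by (simp add: ab)
    show "L $ j $ i = - L $ i $ j" using so_alg_skew[OF *, of b a] by (simp add: ab)
  qed
qed

lemma conjugate_by_perm_surj:
  assumes "bij p"
  shows "\<exists>L. conjugate_by (perm_matrix p) L = A"
proof -
  have "conjugate_by (perm_matrix p) (\<chi> i j. A $ inv p i $ inv p j) = A"
    using assms by (simp add: conjugate_by_perm_matrix vec_eq_iff bij_is_inj)
  then show ?thesis by blast
qed

lemma conjugate_by_perm_block:
  assumes p: "bij p" and "\<And>i. p i \<in> U \<longleftrightarrow> i \<in> W"
  shows "block_diagonal W (conjugate_by (perm_matrix p) L) = block_diagonal U L"
    and "block_antidiagonal W (conjugate_by (perm_matrix p) L) = block_antidiagonal U L"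
proof -
  have surj: "\<exists>a. i = p a" for i using p by (metis bij_pointE)
  show "block_diagonal W (conjugate_by (perm_matrix p) L) = block_diagonal U L"
    "block_antidiagonal W (conjugate_by (perm_matrix p) L) = block_antidiagonal U L"
    unfolding block_diagonal_def block_antidiagonal_def conjugate_by_perm_matrix[OF p]
      vec_lambda_beta assms(2)[symmetric] by (metis surj)+
qed

lemma conjugate_by_perm_image:
  assumes p: "bij p" and U: "\<And>i. p i \<in> U \<longleftrightarrow> i \<in> W"
  shows "conjugate_by (perm_matrix p) ` so_diag U = so_diag W"
    and "conjugate_by (perm_matrix p) ` so_antidiag U = so_antidiag W"
proof -
  let ?c = "conjugate_by (perm_matrix p)"
  have *: "?c ` {L. P L} = {A. Q A}" if "\<And>L. Q (?c L) = P L" for P Q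
  proof
    show "?c ` {L. P L} \<subseteq> {A. Q A}" using that by blast
    show "{A. Q A} \<subseteq> ?c ` {L. P L}"
    proof
      fix A assume "A \<in> {A. Q A}"
      moreover obtain L where "A = ?c L" using conjugate_by_perm_surj[OF p] by metis
      ultimately show "A \<in> ?c ` {L. P L}" using that by blast
    qed
  qed
  show "?c ` so_diag U = so_diag W" "?c ` so_antidiag U = so_antidiag W"
    unfolding so_diag_def so_antidiag_def
    by (rule *; simp only: conjugate_by_perm_so_alg[OF p] conjugate_by_perm_block[OF p U])+
qed

text \<open>The determinant of a permutation matrix is the sign, so a rotation requires an even
  permutation. Bijections between the blocks and between their complements are glued; a wrong sign
  is repaired by first swapping two elements of \<open>W\<close>, which does not affect membership.
  In the application \<open>W\<close> has two elements because it holds at least half of at least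
  three indices.\<close>

lemma exists_even_permutation:
  fixes U W :: "'n::finite set"
  assumes card: "card U = card W" and W: "card W \<ge> 2"
  shows "\<exists>p. p permutes UNIV \<and> sign p = 1 \<and> (\<forall>i. p i \<in> U \<longleftrightarrow> i \<in> W)"
proof -
  obtain f where f: "bij_betw f W U"
    using finite_same_card_bij[of W U] card by auto
  have "card (- W) = card (- U)" using card by (simp add: Compl_eq_Diff_UNIV card_Diff_subset)
  then obtain g where g: "bij_betw g (- W) (- U)"
    using finite_same_card_bij[of "- W" "- U"] by auto
  define p where "p i = (if i \<in> W then f i else g i)" for i
  have pU: "p i \<in> U \<longleftrightarrow> i \<in> W" for i
    using bij_betwE[OF f] bij_betwE[OF g] by (auto simp: p_def)
  have "bij_betw p (W \<union> - W) (U \<union> - U)"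
  proof (rule bij_betw_combine)
    show "bij_betw p W U" using f by (subst bij_betw_cong[of W p f]) (simp_all add: p_def)
    show "bij_betw p (- W) (- U)" using g by (subst bij_betw_cong[of "- W" p g]) (simp_all add: p_def)
  qed auto
  then have "bij p" by simp
  then have p: "p permutes UNIV" by (simp add: permutes_def bij_iff)
  obtain a b where ab: "a \<in> W" "b \<in> W" "a \<noteq> b"
    using W card_le_Suc0_iff_eq[of W] by force
  show ?thesis
  proof (cases "sign p = 1")
    case True
    then show ?thesis using p pU by blast
  next
    case False
    let ?q = "p \<circ> Transposition.transpose a b"
    have "?q permutes UNIV" by (rule permutes_compose[OF permutes_swap_id p]) simp_all
    moreover have "sign ?q = 1"
    proof -
      have "permutation p" unfolding permutation_permutes by (intro exI[of _ UNIV] conjI p) simp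
      then have "sign ?q = sign p * sign (Transposition.transpose a b)"
        by (intro sign_compose permutation_swap_id)
      moreover have "sign p = -1" using False unfolding sign_def by presburger
      ultimately show ?thesis using ab by (simp add: sign_swap_id)
    qed
    moreover have "?q i \<in> U \<longleftrightarrow> i \<in> W" for i
      using ab unfolding comp_apply pU Transposition.transpose_def by auto
    ultimately show ?thesis by blast
  qed
qed

lemma cartan_decomposition_BDI_so_alg:
  fixes W :: "'n::finite set"
  assumes "CARD('n) \<ge> 3" and "q \<ge> 1" "r \<ge> q" "r + q = CARD('n)" "card W = r"
  shows "cartan_decomposition_BDI r q (so_diag W) (so_antidiag W)"
  unfolding cartan_decomposition_BDI_def
proof (intro conjI allI impI cartan_decomposition_so_alg assms)
  fix U :: "'n set" assume "card U = r"
  then obtain p where p: "p permutes UNIV" "sign p = 1" "\<And>i. p i \<in> U \<longleftrightarrow> i \<in> W"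
    using exists_even_permutation[of U W] assms by auto
  have bij: "bij p" using p(1) by (rule permutes_bij)
  have "rotation_matrix (perm_matrix p)"
    unfolding rotation_matrix_def
    using orthogonal_perm_matrix[OF bij] det_perm_matrix[OF p(1)] p(2) by simp
  then show "\<exists>M. rotation_matrix M \<and> so_diag W = conjugate_by M ` bdi_k U \<and>
      so_antidiag W = conjugate_by M ` bdi_p U"
    unfolding bdi_k_eq bdi_p_eq using conjugate_by_perm_image[OF bij p(3)] by metis
qed

section \<open>Simultaneous singular value decomposition\<close>

text \<open>Variational argument: the quadratic form \<open>T x \<bullet> x\<close> attains a
  maximum on the compact unit sphere of \<open>E\<close>, and a maximiser is an eigenvector.\<close>

lemma symmetric_eigenvector:
  fixes T :: "'e::euclidean_space \<Rightarrow> 'e"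
  assumes T: "linear T" and E: "subspace E" "E \<noteq> {0}" and inv: "\<And>x. x \<in> E \<Longrightarrow> T x \<in> E"
    and sym: "\<And>x y. x \<in> E \<Longrightarrow> y \<in> E \<Longrightarrow> T x \<bullet> y = x \<bullet> T y"
  shows "\<exists>v\<in>E. v \<noteq> 0 \<and> (\<exists>c. T v = c *\<^sub>R v)"
proof -
  let ?S = "E \<inter> sphere 0 1"
  obtain e where e: "e \<in> E" "e \<noteq> 0" using E subspace_0 by blast
  have "e /\<^sub>R norm e \<in> ?S" using e E(1) by (simp add: subspace_scale)
  then have ne: "?S \<noteq> {}" by blast
  have cmp: "compact ?S" using closed_subspace[OF E(1)] by (simp add: closed_Int_compact)
  have cont: "continuous_on ?S (\<lambda>x. T x \<bullet> x)"
    by (intro continuous_intros linear_continuous_on linear_conv_bounded_linear[THEN iffD1] T)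
  obtain v where v: "v \<in> ?S" and max: "\<And>x. x \<in> ?S \<Longrightarrow> T x \<bullet> x \<le> T v \<bullet> v"
    using continuous_attains_sup[OF cmp ne cont] by blast
  define M where "M = T v \<bullet> v"
  have vE: "v \<in> E" and vv: "v \<bullet> v = 1" using v by (simp_all add: norm_eq_1)
  have bound: "T x \<bullet> x \<le> M * (x \<bullet> x)" if x: "x \<in> E" for x
  proof (cases "x = 0")
    case True
    then show ?thesis using linear_0[OF T] by simp
  next
    case False
    then have "x /\<^sub>R norm x \<in> ?S" using x E(1) by (simp add: subspace_scale)
    from max[OF this] have "(T x \<bullet> x) / (norm x * norm x) \<le> M"
      by (simp add: linear_scale[OF T] M_def divide_inverse mult.commute mult.left_commute)
    then show ?thesis
      using False by (simp add: divide_le_eq dot_square_norm power2_eq_square)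
  qed
  \<comment> \<open>The residual of the eigenvalue equation, orthogonal to \<open>v\<close>. Moving
    from \<open>v\<close> in the direction \<open>w\<close> changes the form to first order by
    \<open>2 * t * (w \<bullet> w)\<close>, which maximality forbids unless \<open>w\<close>
    vanishes.\<close>
  define w where "w = T v - M *\<^sub>R v"
  have wE: "w \<in> E" unfolding w_def using inv vE E(1) by (simp add: subspace_diff subspace_scale)
  have wv: "w \<bullet> v = 0" using vv by (simp add: w_def inner_diff_left M_def)
  then have vw: "v \<bullet> w = 0" by (simp add: inner_commute)
  have Tvw: "T v \<bullet> w = w \<bullet> w"
  proof -
    have "T v = w + M *\<^sub>R v" by (simp add: w_def)
    then show ?thesis using vw by (simp add: inner_add_left)
  qed
  then have Twv: "T w \<bullet> v = w \<bullet> w" using sym[OF wE vE] by (simp add: inner_commute)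
  define c where "c = M * (w \<bullet> w) - T w \<bullet> w"
  have ineq: "2 * t * (w \<bullet> w) \<le> t * t * c" for t
  proof -
    have "v + t *\<^sub>R w \<in> E" using vE wE E(1) by (simp add: subspace_add subspace_scale)
    from bound[OF this] have "M + 2 * t * (w \<bullet> w) + t * t * (T w \<bullet> w) \<le> M * (1 + t * t * (w \<bullet> w))"
      by (simp add: linear_add[OF T] linear_scale[OF T] inner_add_left inner_add_right vv wv vw
          Tvw Twv M_def[symmetric] algebra_simps)
    then show ?thesis by (simp add: c_def algebra_simps)
  qed
  have "w \<bullet> w = 0"
  proof (rule ccontr)
    assume "w \<bullet> w \<noteq> 0"
    then have pos: "w \<bullet> w > 0" by (simp add: less_le)
    show False
    \<comment> \<open>For positive \<open>c\<close> the choice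
      \<open>t = (w \<bullet> w) / c\<close> makes the linear term dominate the quadratic one;
      otherwise the right-hand side is not positive and \<open>t = 1\<close> suffices.\<close>
    proof (cases "c > 0")
      case True
      have "2 * ((w \<bullet> w) / c) * (w \<bullet> w) \<le> (w \<bullet> w) / c * ((w \<bullet> w) / c) * c" by (rule ineq)
      then have "(w \<bullet> w) * (w \<bullet> w) \<le> 0" using True by (simp add: field_simps)
      moreover have "(w \<bullet> w) * (w \<bullet> w) > 0" using pos by simp
      ultimately show False by linarith
    next
      case False
      then show False using ineq[of 1] pos by simp
    qed
  qed
  then have "T v = M *\<^sub>R v" by (simp add: w_def)
  then show ?thesis using vE vv by (metis inner_zero_left zero_neq_one)
qed

text \<open>Induction on the dimension. Unless every map is scalar on \<open>E\<close>, some
  \<open>T\<close> has an eigenspace that is a proper nonzero subspace, and the other maps preserve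
  it because they commute with \<open>T\<close>.\<close>

lemma common_eigenvector:
  fixes G :: "('e::euclidean_space \<Rightarrow> 'e) set"
  assumes lin: "\<And>T. T \<in> G \<Longrightarrow> linear T"
    and comm: "\<And>S T x. S \<in> G \<Longrightarrow> T \<in> G \<Longrightarrow> S (T x) = T (S x)"
    and sym: "\<And>T x y. T \<in> G \<Longrightarrow> T x \<bullet> y = x \<bullet> T y"
    and E: "subspace E" "E \<noteq> {0}" and inv: "\<And>T x. T \<in> G \<Longrightarrow> x \<in> E \<Longrightarrow> T x \<in> E"
  shows "\<exists>v\<in>E. v \<noteq> 0 \<and> (\<forall>T\<in>G. \<exists>c. T v = c *\<^sub>R v)"
  using E inv
proof (induction "dim E" arbitrary: E rule: less_induct)
  case less
  show ?case
  proof (cases "\<forall>T\<in>G. \<exists>c. \<forall>x\<in>E. T x = c *\<^sub>R x")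
    case True
    obtain e where "e \<in> E" "e \<noteq> 0" using less.prems subspace_0 by blast
    then show ?thesis using True by blast
  next
    case False
    then obtain T where T: "T \<in> G" and nonscalar: "\<And>c. \<exists>x\<in>E. T x \<noteq> c *\<^sub>R x" by blast
    obtain v c where v: "v \<in> E" "v \<noteq> 0" "T v = c *\<^sub>R v"
      using symmetric_eigenvector[OF lin[OF T] less.prems(1,2) less.prems(3)[OF T] sym[OF T]] by blast
    let ?E = "{x \<in> E. T x = c *\<^sub>R x}"
    have sub: "subspace ?E"
      using less.prems(1) linear_add[OF lin[OF T]] linear_scale[OF lin[OF T]] linear_0[OF lin[OF T]]
      by (simp add: subspace_def scaleR_add_right)
    have "?E \<noteq> E" using nonscalar by blast
    then have "dim ?E < dim E"
      using subspace_dim_equal[OF sub less.prems(1)] by (metis (no_types, lifting) mem_Collect_eq not_less subsetI)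
    moreover have "?E \<noteq> {0}" using v by blast
    moreover have "S x \<in> ?E" if "S \<in> G" "x \<in> ?E" for S x
      using that less.prems(3) comm[OF T, of S] linear_scale[OF lin[OF \<open>S \<in> G\<close>]] by simp
    ultimately obtain w where "w \<in> ?E" "w \<noteq> 0" "\<forall>T\<in>G. \<exists>c. T w = c *\<^sub>R w"
      using less.hyps[of ?E] sub by blast
    then show ?thesis by blast
  qed
qed

lemma exists_unit_vector:
  assumes "subspace E" "E \<noteq> {0 :: 'e::euclidean_space}"
  shows "\<exists>v\<in>E. v \<bullet> v = 1"
proof -
  obtain e where e: "e \<in> E" "e \<noteq> 0" using assms subspace_0 by blast
  then have "e /\<^sub>R norm e \<in> E" using assms(1) by (simp add: subspace_scale)
  moreover have "(e /\<^sub>R norm e) \<bullet> (e /\<^sub>R norm e) = 1"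
    using e by (simp add: dot_square_norm power2_eq_square)
  ultimately show ?thesis by blast
qed

lemma dim_orthogonal_hyperplane:
  fixes v :: "'e::euclidean_space"
  assumes B: "subspace B" and v: "v \<in> B" "v \<noteq> 0"
  shows "dim {y \<in> B. v \<bullet> y = 0} + 1 = dim B" "subspace {y \<in> B. v \<bullet> y = 0}"
proof -
  have "span {v} \<subseteq> B" using B v by (simp add: span_minimal)
  from dim_subspace_orthogonal_to_vectors[OF subspace_span B this]
  have "dim {y \<in> B. \<forall>x\<in>span {v}. orthogonal x y} + dim (span {v}) = dim B" .
  moreover have "(\<forall>x\<in>span {v}. orthogonal x y) \<longleftrightarrow> v \<bullet> y = 0" for y
    by (auto simp: span_singleton orthogonal_def)
  moreover have "dim (span {v}) = 1" using v by (simp add: dim_span)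
  ultimately show "dim {y \<in> B. v \<bullet> y = 0} + 1 = dim B" by simp
  show "subspace {y \<in> B. v \<bullet> y = 0}"
    using B by (simp add: subspace_def inner_add_right)
qed

text \<open>One step of a simultaneous singular value decomposition. The maps \<open>X Y\<close> restricted to
  \<open>B\<close> are symmetric and commute. If some \<open>X0\<close> does not vanish on \<open>B\<close>, the common eigenvector \<open>v\<close> is
  taken in \<open>X0 (X0 B)\<close>, where \<open>X0\<close> is injective, and \<open>u\<close> is the direction of \<open>X0 v\<close>.\<close>

lemma common_singular_pair:
  fixes F :: "('e::euclidean_space \<Rightarrow> 'e) set"
  assumes lin: "\<And>X. X \<in> F \<Longrightarrow> linear X"
    and comm: "\<And>X Y x. X \<in> F \<Longrightarrow> Y \<in> F \<Longrightarrow> X (Y x) = Y (X x)"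
    and skew: "\<And>X x y. X \<in> F \<Longrightarrow> X x \<bullet> y = - (x \<bullet> X y)"
    and A: "subspace A" "A \<noteq> {0}" and B: "subspace B" "B \<noteq> {0}"
    and AB: "\<And>X x. X \<in> F \<Longrightarrow> x \<in> A \<Longrightarrow> X x \<in> B"
    and BA: "\<And>X x. X \<in> F \<Longrightarrow> x \<in> B \<Longrightarrow> X x \<in> A"
  shows "\<exists>u\<in>A. \<exists>v\<in>B. u \<bullet> u = 1 \<and> v \<bullet> v = 1 \<and>
    (\<forall>X\<in>F. \<exists>c. X v = c *\<^sub>R u \<and> X u = - c *\<^sub>R v)"
proof (cases "\<forall>X\<in>F. \<forall>b\<in>B. X b = 0")
  case True
  \<comment> \<open>Maps vanishing on \<open>B\<close> also vanish on \<open>A\<close>, by skewness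
    and \<open>X a \<in> B\<close>. Any two unit vectors then form a pair with all singular values
    zero.\<close>
  have XA: "X a = 0" if "X \<in> F" "a \<in> A" for X a
  proof -
    have "X a \<bullet> X a = - (a \<bullet> X (X a))" by (rule skew[OF that(1)])
    also have "X (X a) = 0" by (rule True[rule_format, OF that(1) AB[OF that]])
    finally show ?thesis by simp
  qed
  obtain u v where "u \<in> A" "u \<bullet> u = 1" "v \<in> B" "v \<bullet> v = 1"
    using exists_unit_vector A B by metis
  moreover have "\<forall>X\<in>F. \<exists>c. X v = c *\<^sub>R u \<and> X u = - c *\<^sub>R v"
    using True XA calculation by (intro ballI exI[of _ 0]) simp
  ultimately show ?thesis by blast
next
  case False
  then obtain X0 b where X0: "X0 \<in> F" and b: "b \<in> B" "X0 b \<noteq> 0" by blast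
  let ?E = "(\<lambda>x. X0 (X0 x)) ` B"
  let ?G = "{\<lambda>x. X (Y x) | X Y. X \<in> F \<and> Y \<in> F}"
  have lin2: "linear (\<lambda>x. X (Y x))" if "X \<in> F" "Y \<in> F" for X Y
    using linear_compose[OF lin[OF that(2)] lin[OF that(1)]] by (simp add: o_def)
  have E: "subspace ?E" by (rule linear_subspace_image[OF lin2[OF X0 X0] B(1)])
  \<comment> \<open>A skew map has the same kernel as its square.\<close>
  have "X0 (X0 b) \<noteq> 0"
  proof
    assume "X0 (X0 b) = 0"
    then have "X0 b \<bullet> X0 b = 0" using skew[OF X0, of b "X0 b"] by simp
    then show False using b by simp
  qed
  then have ne: "?E \<noteq> {0}" using b by blast
  have "\<exists>v\<in>?E. v \<noteq> 0 \<and> (\<forall>T\<in>?G. \<exists>c. T v = c *\<^sub>R v)"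
  proof (rule common_eigenvector[OF _ _ _ E ne])
    show "linear T" if T: "T \<in> ?G" for T
    proof -
      obtain X Y where *: "T = (\<lambda>x. X (Y x))" "X \<in> F" "Y \<in> F" using T by blast
      show ?thesis unfolding *(1) by (rule lin2[OF *(2,3)])
    qed
    show "S (T x) = T (S x)" if ST: "S \<in> ?G" "T \<in> ?G" for S T x
    proof -
      obtain X Y X' Y' where *: "S = (\<lambda>x. X (Y x))" "T = (\<lambda>x. X' (Y' x))" "X \<in> F" "Y \<in> F" "X' \<in> F" "Y' \<in> F"
        using ST by blast
      show ?thesis
        unfolding *(1,2) comm[OF *(4,5), of "Y' x"] comm[OF *(4,6), of x]
          comm[OF *(3,5), of "Y' (Y x)"] comm[OF *(3,6), of "Y x"] ..
    qed
    show "T x \<bullet> y = x \<bullet> T y" if T: "T \<in> ?G" for T x y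
    proof -
      obtain X Y where *: "T = (\<lambda>x. X (Y x))" "X \<in> F" "Y \<in> F" using T by blast
      show ?thesis
        unfolding *(1) skew[OF *(2), of "Y x" y] skew[OF *(3), of x "X y"] comm[OF *(2,3), of y] by simp
    qed
    show "T x \<in> ?E" if T: "T \<in> ?G" and x: "x \<in> ?E" for T x
    proof -
      obtain X Y b where *: "T = (\<lambda>x. X (Y x))" "X \<in> F" "Y \<in> F" "b \<in> B" "x = X0 (X0 b)"
        using T x by blast
      have "T x = X0 (X0 (X (Y b)))"
        unfolding *(1,5) comm[OF *(3) X0, of "X0 b"] comm[OF *(3) X0, of b]
          comm[OF *(2) X0, of "X0 (Y b)"] comm[OF *(2) X0, of "Y b"] ..
      moreover have "X (Y b) \<in> B" by (rule AB[OF *(2) BA[OF *(3,4)]])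
      ultimately show ?thesis by blast
    qed
  qed
  then obtain v0 where v0: "v0 \<in> ?E" "v0 \<noteq> 0"
    and G: "\<forall>T\<in>?G. \<exists>c. T v0 = c *\<^sub>R v0" by (elim bexE conjE)
  have eig0: "\<exists>c. X (Y v0) = c *\<^sub>R v0" if "X \<in> F" "Y \<in> F" for X Y
  proof -
    have "(\<lambda>x. X (Y x)) \<in> ?G" using that by blast
    from G[rule_format, OF this] show ?thesis .
  qed
  define v where "v = v0 /\<^sub>R norm v0"
  have vv: "v \<bullet> v = 1" using v0(2) by (simp add: v_def dot_square_norm power2_eq_square)
  have vE: "v \<in> ?E" unfolding v_def by (rule subspace_scale[OF E v0(1)])
  then obtain b' where b': "b' \<in> B" "v = X0 (X0 b')" by blast
  have vB: "v \<in> B" unfolding b'(2) by (rule AB[OF X0 BA[OF X0 b'(1)]])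
  have eig: "\<exists>c. X (Y v) = c *\<^sub>R v" if XY: "X \<in> F" "Y \<in> F" for X Y
  proof -
    obtain c where "X (Y v0) = c *\<^sub>R v0" using eig0[OF XY] by blast
    then have "X (Y v) = c *\<^sub>R v"
      unfolding v_def by (simp add: linear_scale[OF lin[OF XY(1)]] linear_scale[OF lin[OF XY(2)]])
    then show ?thesis by blast
  qed
  define w where "w = X0 v"
  \<comment> \<open>Since \<open>v\<close> lies in the image of \<open>X0\<close>, which is
    orthogonal to the kernel of the skew map \<open>X0\<close>, it is not annihilated.\<close>
  have w: "w \<noteq> 0"
  proof
    assume "w = 0"
    then have "v \<bullet> v = 0" using skew[OF X0, of "X0 b'" v] b'(2) by (simp add: w_def)
    then show False using vv by simp
  qed
  define u where "u = w /\<^sub>R norm w"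
  have uu: "u \<bullet> u = 1" using w by (simp add: u_def dot_square_norm power2_eq_square)
  have uA: "u \<in> A" unfolding u_def w_def by (rule subspace_scale[OF A(1) BA[OF X0 vB]])
  obtain m0 where m0: "X0 w = m0 *\<^sub>R v" unfolding w_def using eig[OF X0 X0] by blast
  have m0_nz: "m0 \<noteq> 0"
  proof
    assume "m0 = 0"
    then have "w \<bullet> w = 0" using skew[OF X0, of v w] m0 by (simp add: w_def)
    then show False using w by simp
  qed
  have "\<exists>c. X v = c *\<^sub>R u \<and> X u = - c *\<^sub>R v" if X: "X \<in> F" for X
  proof -
    obtain m where m: "X w = m *\<^sub>R v" unfolding w_def using eig[OF X X0] by blast
    \<comment> \<open>Eigenvectors of products only control \<open>X w\<close>. Commuting
      \<open>X\<close> past \<open>X0\<close> and dividing by \<open>m0\<close> transfers this to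
      \<open>X v\<close>, which becomes parallel to \<open>X0 v\<close>.\<close>
    have "m0 *\<^sub>R X v = X (X0 w)" by (simp add: m0 linear_scale[OF lin[OF X]])
    also have "\<dots> = X0 (X w)" by (rule comm[OF X X0])
    also have "\<dots> = m *\<^sub>R w" unfolding m by (simp add: linear_scale[OF lin[OF X0]] w_def)
    finally have *: "m0 *\<^sub>R X v = m *\<^sub>R w" .
    have "X v = inverse m0 *\<^sub>R (m0 *\<^sub>R X v)" using m0_nz by simp
    also have "\<dots> = (m / m0) *\<^sub>R w" unfolding * by (simp add: divide_inverse mult.commute)
    finally have Xv: "X v = (m / m0 * norm w) *\<^sub>R u"
      using w by (simp add: u_def)
    have Xu: "X u = (m / norm w) *\<^sub>R v"
      by (simp add: u_def linear_scale[OF lin[OF X]] m divide_inverse mult.commute)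
    \<comment> \<open>Skewness ties the scalars for \<open>X v\<close> and \<open>X u\<close>
      together: they are opposite, as the single constant \<open>c\<close> demands.\<close>
    have "m / norm w = X u \<bullet> v" using vv by (simp add: Xu)
    also have "\<dots> = - (u \<bullet> X v)" by (rule skew[OF X])
    also have "\<dots> = - (m / m0 * norm w)" using uu by (simp add: Xv)
    finally show ?thesis using Xv Xu by (intro exI[of _ "m / m0 * norm w"]) simp
  qed
  then show ?thesis using uA vB uu vv by blast
qed

text \<open>Induction on the dimension of the smaller space: a common singular pair is split off,
  and the hyperplanes orthogonal to it are again exchanged by all maps. The bound on
  \<open>dim A\<close> leaves a partner in \<open>A\<close> for every vector found in
  \<open>B\<close>.\<close>

lemma simultaneous_svd:
  fixes F :: "('e::euclidean_space \<Rightarrow> 'e) set"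
  assumes lin: "\<And>X. X \<in> F \<Longrightarrow> linear X"
    and comm: "\<And>X Y x. X \<in> F \<Longrightarrow> Y \<in> F \<Longrightarrow> X (Y x) = Y (X x)"
    and skew: "\<And>X x y. X \<in> F \<Longrightarrow> X x \<bullet> y = - (x \<bullet> X y)"
    and A: "subspace A" and B: "subspace B" and dim: "dim B = m" "m \<le> dim A"
    and AB: "\<And>X x. X \<in> F \<Longrightarrow> x \<in> A \<Longrightarrow> X x \<in> B"
    and BA: "\<And>X x. X \<in> F \<Longrightarrow> x \<in> B \<Longrightarrow> X x \<in> A"
  shows "\<exists>u v. (\<forall>i<m. u i \<in> A \<and> v i \<in> B) \<and>
    (\<forall>i<m. \<forall>j<m. u i \<bullet> u j = of_bool (i = j) \<and> v i \<bullet> v j = of_bool (i = j)) \<and>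
    (\<forall>X\<in>F. \<forall>i<m. \<exists>c. X (v i) = c *\<^sub>R u i)"
  using A B dim AB BA
proof (induction m arbitrary: A B)
  case 0
  show ?case by simp
next
  case (Suc m)
  have ne: "A \<noteq> {0}" "B \<noteq> {0}" using Suc.prems(3,4) by auto
  have ex: "\<exists>u\<in>A. \<exists>v\<in>B. u \<bullet> u = 1 \<and> v \<bullet> v = 1 \<and>
      (\<forall>X\<in>F. \<exists>c. X v = c *\<^sub>R u \<and> X u = - c *\<^sub>R v)"
    by (rule common_singular_pair)
      (fact lin comm skew ne Suc.prems(1) Suc.prems(2) Suc.prems(5) Suc.prems(6))+
  obtain u v where u: "u \<in> A" "u \<bullet> u = 1" and v: "v \<in> B" "v \<bullet> v = 1"
    and uv: "\<And>X. X \<in> F \<Longrightarrow> \<exists>c. X v = c *\<^sub>R u \<and> X u = - c *\<^sub>R v"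
    using ex by blast
  let ?A = "{y \<in> A. u \<bullet> y = 0}" and ?B = "{y \<in> B. v \<bullet> y = 0}"
  have u0: "u \<noteq> 0" and v0: "v \<noteq> 0" using u v by auto
  have "dim ?B = m" "m \<le> dim ?A"
    using dim_orthogonal_hyperplane(1)[OF Suc.prems(1) u(1) u0]
      dim_orthogonal_hyperplane(1)[OF Suc.prems(2) v(1) v0] Suc.prems(3,4) by simp_all
  moreover have "X x \<in> ?B" if X: "X \<in> F" and x: "x \<in> ?A" for X x
  proof -
    obtain c where "X v = c *\<^sub>R u" using uv[OF X] by blast
    \<comment> \<open>Skewness moves \<open>X\<close> onto \<open>v\<close>, giving a multiple of
      \<open>u\<close>, to which \<open>x\<close> is orthogonal.\<close>
    then have "v \<bullet> X x = 0" using skew[OF X, of v x] x by simp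
    then show ?thesis using Suc.prems(5)[OF X] x by simp
  qed
  moreover have "X x \<in> ?A" if X: "X \<in> F" and x: "x \<in> ?B" for X x
  proof -
    obtain c where "X u = - c *\<^sub>R v" using uv[OF X] by blast
    then have "u \<bullet> X x = 0" using skew[OF X, of u x] x by simp
    then show ?thesis using Suc.prems(6)[OF X] x by simp
  qed
  ultimately obtain u' v' where in': "\<And>i. i < m \<Longrightarrow> u' i \<in> ?A \<and> v' i \<in> ?B"
    and orth': "\<And>i j. i < m \<Longrightarrow> j < m \<Longrightarrow> u' i \<bullet> u' j = of_bool (i = j) \<and> v' i \<bullet> v' j = of_bool (i = j)"
    and sv': "\<And>X i. X \<in> F \<Longrightarrow> i < m \<Longrightarrow> \<exists>c. X (v' i) = c *\<^sub>R u' i"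
    using Suc.IH[OF dim_orthogonal_hyperplane(2)[OF Suc.prems(1) u(1) u0]
        dim_orthogonal_hyperplane(2)[OF Suc.prems(2) v(1) v0]] by blast
  let ?u = "u'(m := u)" and ?v = "v'(m := v)"
  have "?u i \<in> A \<and> ?v i \<in> B" if "i < Suc m" for i
    using that in' u v by (cases "i = m") auto
  moreover have "?u i \<bullet> ?u j = of_bool (i = j) \<and> ?v i \<bullet> ?v j = of_bool (i = j)"
    if "i < Suc m" "j < Suc m" for i j
    using that in' orth' u v by (cases "i = m"; cases "j = m") (auto simp: inner_commute less_Suc_eq)
  moreover have "\<exists>c. X (?v i) = c *\<^sub>R ?u i" if "X \<in> F" "i < Suc m" for X i
    using that sv'[of X i] uv[of X] by (cases "i = m") auto
  ultimately show ?case by blast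
qed

section \<open>Cartan subalgebras\<close>

lemma linear_complexify: "linear (complexify :: real^'n^'m \<Rightarrow> complex^'n^'m)"
  by (rule linearI) (simp_all add: vec_eq_iff scaleR_conv_of_real[where 'a = complex])

lemma inj_complexify: "inj complexify"
  by (rule injI) (simp add: vec_eq_iff)

lemma commutator_complexify: "commutator (complexify R) (complexify S) = complexify (R ** S - S ** R)"
  unfolding commutator_def complexify_mult by (rule linear_diff[OF linear_complexify, symmetric])

text \<open>The real form of \<open>so_antidiag\<close>: its members act on \<open>real^'n\<close>,
  where the real inner product and the singular value argument live.\<close>

definition skew_antidiag :: "'n::finite set \<Rightarrow> (real^'n^'n) set" where
  "skew_antidiag W = {R. complexify R \<in> so_antidiag W}"

lemma subspace_skew_antidiag: "subspace (skew_antidiag W)"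
proof -
  have "skew_antidiag W = complexify -` so_antidiag W" by (auto simp: skew_antidiag_def)
  then show ?thesis using linear_subspace_vimage[OF linear_complexify subspace_block(2)] by metis
qed

lemma skew_antidiag_skew:
  assumes "R \<in> skew_antidiag W"
  shows "R $ j $ i = - R $ i $ j"
proof -
  have "complexify R \<in> so_alg" using assms by (simp add: skew_antidiag_def so_antidiag_def)
  from so_alg_skew[OF this, of j i] show ?thesis
    by (metis complexify_component of_real_eq_iff of_real_minus)
qed

lemma skew_antidiag_zero:
  assumes "R \<in> skew_antidiag W" "(i \<in> W) = (j \<in> W)"
  shows "R $ i $ j = 0"
proof -
  have "block_antidiagonal W (complexify R)" using assms(1) by (simp add: skew_antidiag_def so_antidiag_def)
  then have "complexify R $ i $ j = 0" using assms(2) unfolding block_antidiagonal_def by blast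
  then show ?thesis by simp
qed

lemma skew_antidiag_inner:
  assumes "R \<in> skew_antidiag W"
  shows "(R *v x) \<bullet> y = - (x \<bullet> (R *v y))"
proof -
  have "transpose R = - R"
    using skew_antidiag_skew[OF assms] unfolding vec_eq_iff transpose_def
      vec_lambda_beta vector_uminus_component by blast
  moreover have "(- R) *v x = - (R *v x)"
    by (simp add: vec_eq_iff matrix_vector_mult_def sum_negf)
  ultimately have "x v* R = - (R *v x)"
    by (metis transpose_matrix_vector)
  then show ?thesis using dot_lmul_matrix[of x R y] by simp
qed

definition coord_subspace :: "'n set \<Rightarrow> (real^'n) set" where
  "coord_subspace W = {x. \<forall>i. i \<notin> W \<longrightarrow> x $ i = 0}"

lemma subspace_coord: "subspace (coord_subspace W)"
  by (simp add: subspace_def coord_subspace_def)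

lemma dim_coord: "dim (coord_subspace W) = card (W :: 'n::finite set)"
  unfolding coord_subspace_def dim_vec_eq[symmetric] by (rule dim_substandard_cart)

lemma coord_orthogonal: "x \<in> coord_subspace W \<Longrightarrow> y \<in> coord_subspace (- W) \<Longrightarrow> x \<bullet> y = 0"
  unfolding coord_subspace_def inner_vec_def
  by (intro sum.neutral ballI) (metis (mono_tags, lifting) ComplD mem_Collect_eq inner_zero_left inner_zero_right)

lemma skew_antidiag_maps:
  assumes R: "R \<in> skew_antidiag W"
  shows "x \<in> coord_subspace W \<Longrightarrow> R *v x \<in> coord_subspace (- W)"
    and "x \<in> coord_subspace (- W) \<Longrightarrow> R *v x \<in> coord_subspace W"
proof -
  have "R $ i $ j * x $ j = 0" if "x \<in> coord_subspace W" "i \<in> W" for i j x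
    using that skew_antidiag_zero[OF R, of i j] by (cases "j \<in> W") (auto simp: coord_subspace_def)
  then show "x \<in> coord_subspace W \<Longrightarrow> R *v x \<in> coord_subspace (- W)"
    unfolding coord_subspace_def[of "- W"] matrix_vector_mult_def
    by (auto intro!: sum.neutral)
  have "R $ i $ j * x $ j = 0" if "x \<in> coord_subspace (- W)" "i \<notin> W" for i j x
    using that skew_antidiag_zero[OF R, of i j] by (cases "j \<in> W") (auto simp: coord_subspace_def)
  then show "x \<in> coord_subspace (- W) \<Longrightarrow> R *v x \<in> coord_subspace W"
    unfolding coord_subspace_def[of W] matrix_vector_mult_def
    by (auto intro!: sum.neutral)
qed

text \<open>The rank-two generator of rotations in the plane of \<open>u\<close> and
  \<open>v\<close>. For an orthonormal pair it sends \<open>v\<close> to \<open>u\<close> and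
  \<open>u\<close> to \<open>- v\<close>, and it annihilates the orthogonal complement of the
  plane.\<close>

definition wedge :: "real^'n \<Rightarrow> real^'n \<Rightarrow> real^'n^'n" where
  "wedge u v = (\<chi> i j. u $ i * v $ j - v $ i * u $ j)"

lemma wedge_mult: "wedge u v *v x = (v \<bullet> x) *\<^sub>R u - (u \<bullet> x) *\<^sub>R v"
  unfolding wedge_def vec_eq_iff matrix_vector_mult_def inner_vec_def
    vector_minus_component vector_scaleR_component vec_lambda_beta
  by (simp add: sum_distrib_left sum_subtractf[symmetric] algebra_simps)

lemma wedge_skew_antidiag:
  assumes "u \<in> coord_subspace W" "v \<in> coord_subspace (- W)"
  shows "wedge u v \<in> skew_antidiag W"
proof -
  have "complexify (wedge u v) \<in> so_alg"
    by (rule so_algI) (simp_all add: wedge_def)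
  moreover have "wedge u v $ i $ j = 0" if "(i \<in> W) = (j \<in> W)" for i j
    using assms that by (cases "i \<in> W") (auto simp: wedge_def coord_subspace_def)
  then have "block_antidiagonal W (complexify (wedge u v))"
    unfolding block_antidiagonal_def by simp
  ultimately show ?thesis by (simp add: skew_antidiag_def so_antidiag_def)
qed

lemma orthonormal_span:
  fixes v :: "nat \<Rightarrow> 'e::euclidean_space"
  assumes B: "subspace B" "dim B = m" and v: "\<And>i. i < m \<Longrightarrow> v i \<in> B"
    and orth: "\<And>i j. i < m \<Longrightarrow> j < m \<Longrightarrow> v i \<bullet> v j = of_bool (i = j)"
  shows "B \<subseteq> span (v ` {..<m})"
proof -
  have inj: "inj_on v {..<m}"
  proof (rule inj_onI)
    fix i j assume ij: "i \<in> {..<m}" "j \<in> {..<m}" "v i = v j"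
    then have "v i \<bullet> v j = 1" using orth[of j j] by simp
    then show "i = j" using orth[of i j] ij by (simp split: if_splits)
  qed
  have "pairwise orthogonal (v ` {..<m})"
    unfolding pairwise_def orthogonal_def using orth by auto
  moreover have "0 \<notin> v ` {..<m}"
  proof
    assume "0 \<in> v ` {..<m}"
    then obtain i where "i < m" "v i = 0" by auto
    then show False using orth[of i i] by simp
  qed
  ultimately have "independent (v ` {..<m})" by (rule pairwise_orthogonal_independent)
  moreover have "card (v ` {..<m}) = m" using card_image[OF inj] by simp
  ultimately show ?thesis
    using v B(2) by (intro card_ge_dim_independent) auto
qed

text \<open>A maximal abelian subalgebra has a simultaneous singular value decomposition with singular
  vectors \<open>u i\<close>, \<open>v i\<close>; the abelian algebra spanned by all \<open>wedge (u i) (v i)\<close> contains it,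
  hence equals it.\<close>

lemma dim_cartan_subalgebra:
  fixes W :: "'n::finite set"
  assumes a: "cartan_subalgebra (so_antidiag W) a" and card: "card (- W) \<le> card W"
  shows "dim a = card (- W)"
proof -
  have ab: "\<And>X Y. X \<in> a \<Longrightarrow> Y \<in> a \<Longrightarrow> commutator X Y = 0" and sub: "a \<subseteq> so_antidiag W"
    and max: "\<And>b. abelian_subalgebra b \<Longrightarrow> a \<subseteq> b \<Longrightarrow> b \<subseteq> so_antidiag W \<Longrightarrow> b = a"
    using a unfolding cartan_subalgebra_def abelian_subalgebra_def by blast+
  define P where "P = {R :: real^'n^'n. complexify R \<in> a}"
  have P: "R \<in> skew_antidiag W" if "R \<in> P" for R
    using that sub by (auto simp: P_def skew_antidiag_def)
  let ?A = "coord_subspace W" and ?B = "coord_subspace (- W)" and ?q = "card (- W)"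
  have "\<exists>u v. (\<forall>i<?q. u i \<in> ?A \<and> v i \<in> ?B) \<and>
    (\<forall>i<?q. \<forall>j<?q. u i \<bullet> u j = of_bool (i = j) \<and> v i \<bullet> v j = of_bool (i = j)) \<and>
    (\<forall>X\<in>(\<lambda>R x. R *v x) ` P. \<forall>i<?q. \<exists>c. X (v i) = c *\<^sub>R u i)"
  proof (rule simultaneous_svd)
    show "linear X" if "X \<in> (\<lambda>R x. R *v x) ` P" for X
      using that by auto
    show "X (Y x) = Y (X x)" if X: "X \<in> (\<lambda>R x. R *v x) ` P" and Y: "Y \<in> (\<lambda>R x. R *v x) ` P" for X Y x
    proof -
      obtain R S where R: "X = (\<lambda>x. R *v x)" "R \<in> P" and S: "Y = (\<lambda>x. S *v x)" "S \<in> P"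
        using X Y by blast
      have "complexify (R ** S - S ** R) = complexify 0"
        using ab[of "complexify R" "complexify S"] R S commutator_complexify[of R S]
          linear_0[OF linear_complexify] by (simp add: P_def)
      then have "R ** S - S ** R = 0" by (rule injD[OF inj_complexify])
      then show ?thesis by (simp add: R S matrix_vector_mul_assoc)
    qed
    show "X x \<bullet> y = - (x \<bullet> X y)" if X: "X \<in> (\<lambda>R x. R *v x) ` P" for X x y
      using X skew_antidiag_inner[OF P] by blast
    show "X x \<in> ?B" if X: "X \<in> (\<lambda>R x. R *v x) ` P" and "x \<in> ?A" for X x
      using that skew_antidiag_maps(1)[OF P] by blast
    show "X x \<in> ?A" if X: "X \<in> (\<lambda>R x. R *v x) ` P" and "x \<in> ?B" for X x
      using that skew_antidiag_maps(2)[OF P] by blast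
  qed (simp_all add: subspace_coord dim_coord card)
  then obtain u v where in_AB: "\<forall>i<?q. u i \<in> ?A \<and> v i \<in> ?B"
    and orth: "\<forall>i<?q. \<forall>j<?q. u i \<bullet> u j = of_bool (i = j) \<and> v i \<bullet> v j = of_bool (i = j)"
    and sv: "\<forall>X\<in>(\<lambda>R x. R *v x) ` P. \<forall>i<?q. \<exists>c. X (v i) = c *\<^sub>R u i"
    by (elim exE conjE)
  have uv: "u i \<in> ?A" "v i \<in> ?B" if "i < ?q" for i
    using in_AB that by simp_all
  have uu: "u i \<bullet> u j = of_bool (i = j)" and vv: "v i \<bullet> v j = of_bool (i = j)"
    if "i < ?q" "j < ?q" for i j
    using orth that by simp_all
  have uv0: "u i \<bullet> v j = 0" "v j \<bullet> u i = 0" if "i < ?q" "j < ?q" for i j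
    using coord_orthogonal[OF uv(1)[OF that(1)] uv(2)[OF that(2)]] by (simp_all add: inner_commute)
  define E where "E i = wedge (u i) (v i)" for i
  have E_P: "E i \<in> skew_antidiag W" if "i < ?q" for i
    unfolding E_def by (rule wedge_skew_antidiag[OF uv(1)[OF that] uv(2)[OF that]])
  have E_v: "E i *v v j = (if i = j then u i else 0)" if "i < ?q" "j < ?q" for i j
    unfolding E_def wedge_mult using vv[OF that] uv0[OF that] by simp
  have E_u: "E i *v u j = (if i = j then - v i else 0)" if "i < ?q" "j < ?q" for i j
    unfolding E_def wedge_mult using uu[OF that] uv0(2)[OF that(2,1)] by simp
  have E_E: "E i ** E j = E j ** E i" if ij: "i < ?q" "j < ?q" for i j
  proof (cases "i = j")
    case False
    \<comment> \<open>Distinct generators act in mutually orthogonal planes: the image of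
      \<open>E j\<close> lies in the plane of \<open>u j\<close> and \<open>v j\<close>, which
      \<open>E i\<close> annihilates.\<close>
    have zero: "E i ** E j = 0" if "i < ?q" "j < ?q" "i \<noteq> j" for i j
    proof -
      have "E i *v (E j *v x) = 0" for x
      proof -
        have "E j *v x = (v j \<bullet> x) *\<^sub>R u j - (u j \<bullet> x) *\<^sub>R v j"
          by (simp add: E_def wedge_mult)
        then show ?thesis using that E_u[of i j] E_v[of i j]
          by (simp add: matrix_vector_mult_diff_distrib matrix_vector_mult_scaleR)
      qed
      then show ?thesis by (simp add: matrix_eq matrix_vector_mul_assoc[symmetric])
    qed
    show ?thesis using zero[OF ij False] zero[OF ij(2,1)] False by simp
  qed simp
  define S where "S = span (E ` {..<?q})"
  have "P \<subseteq> S"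
  proof
    fix R assume R: "R \<in> P"
    obtain c where c: "\<And>i. i < ?q \<Longrightarrow> R *v v i = c i *\<^sub>R u i"
      using sv R by (metis image_eqI)
    \<comment> \<open>The remainder kills every \<open>v i\<close>, and these span the lower block
      because their number is its dimension.\<close>
    define D where "D = R - (\<Sum>i<?q. c i *\<^sub>R E i)"
    have sum_S: "(\<Sum>i<?q. c i *\<^sub>R E i) \<in> S"
      unfolding S_def by (intro span_sum span_scale span_base) auto
    have D: "D \<in> skew_antidiag W"
      unfolding D_def
      by (intro subspace_diff subspace_sum subspace_scale subspace_skew_antidiag P R E_P) auto
    have lin: "linear (\<lambda>M :: real^'n^'n. M *v x)" for x
      by (rule linearI) (simp_all add: matrix_vector_mult_add_rdistrib scaleR_matrix_vector_assoc)
    have "D *v v j = 0" if j: "j < ?q" for j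
    proof -
      have "(\<Sum>i<?q. c i *\<^sub>R E i) *v v j = (\<Sum>i<?q. c i *\<^sub>R (E i *v v j))"
        using linear_sum[OF lin[of "v j"], of "\<lambda>i. c i *\<^sub>R E i" "{..<?q}"]
        by (simp add: scaleR_matrix_vector_assoc)
      also have "\<dots> = (\<Sum>i<?q. if i = j then c j *\<^sub>R u j else 0)"
        by (intro sum.cong refl) (simp add: E_v j)
      also have "\<dots> = c j *\<^sub>R u j" using j by simp
      finally show ?thesis using c[OF j] by (simp add: D_def matrix_vector_mult_diff_rdistrib)
    qed
    then have "span (v ` {..<?q}) \<subseteq> {x. D *v x = 0}"
      by (intro span_minimal linear_subspace_kernel) auto
    moreover have "?B \<subseteq> span (v ` {..<?q})"
      by (rule orthonormal_span[OF subspace_coord dim_coord uv(2) vv])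
    ultimately have DB: "D *v x = 0" if "x \<in> ?B" for x using that by blast
    \<comment> \<open>The vectors \<open>u i\<close> need not span the larger block. There the
      remainder vanishes because it maps into the lower block, where it is already zero, and a skew
      map with \<open>D *v (D *v x) = 0\<close> has \<open>D *v x = 0\<close>.\<close>
    have DA: "D *v x = 0" if "x \<in> ?A" for x
    proof -
      have "D *v (D *v x) = 0" by (rule DB[OF skew_antidiag_maps(1)[OF D that]])
      then have "(D *v x) \<bullet> (D *v x) = 0" using skew_antidiag_inner[OF D, of x "D *v x"] by simp
      then show ?thesis by simp
    qed
    have "D *v x = 0" for x
    proof -
      let ?y = "\<chi> i. if i \<in> W then x $ i else 0" and ?z = "\<chi> i. if i \<in> W then 0 else x $ i"
      have "x = ?y + ?z" by (simp add: vec_eq_iff)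
      moreover have "D *v ?y = 0" by (rule DA) (simp add: coord_subspace_def)
      moreover have "D *v ?z = 0" by (rule DB) (simp add: coord_subspace_def)
      ultimately show ?thesis by (metis add_0 matrix_vector_right_distrib)
    qed
    then have "D = 0" by (simp add: matrix_eq)
    then have "R = (\<Sum>i<?q. c i *\<^sub>R E i)" by (simp add: D_def)
    then show "R \<in> S" using sum_S by simp
  qed
  define b where "b = span ((\<lambda>i. complexify (E i)) ` {..<?q})"
  have bS: "b = complexify ` S"
    unfolding b_def S_def using linear_span_image[OF linear_complexify, of "E ` {..<?q}"]
    by (simp add: image_image)
  have "a \<subseteq> b"
  proof
    fix X assume X: "X \<in> a"
    then have "X \<in> so_alg" using sub by (auto simp: so_antidiag_def)
    then obtain R where R: "X = complexify R" unfolding so_alg_def by blast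
    then have "R \<in> P" using X by (simp add: P_def)
    then show "X \<in> b" using \<open>P \<subseteq> S\<close> R bS by blast
  qed
  moreover have b_sub: "b \<subseteq> so_antidiag W"
    unfolding b_def
    by (intro span_minimal subspace_block) (use E_P in \<open>auto simp: skew_antidiag_def\<close>)
  moreover have b_comm: "commutator X Y = 0" if X: "X \<in> b" and Y: "Y \<in> b" for X Y
  proof -
    \<comment> \<open>Commutativity passes from the generators to their span one argument at a time;
      the vanishing of a commutator is symmetric in its arguments.\<close>
    have ker: "subspace {Y. commutator X Y = 0}" for X :: "complex^'n^'n"
      by (rule linear_subspace_kernel[OF linear_commutator])
    have 1: "commutator (complexify (E i)) Y = 0" if "i < ?q" "Y \<in> b" for i Y
    proof -
      have "b \<subseteq> {Y. commutator (complexify (E i)) Y = 0}"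
        unfolding b_def
        by (intro span_minimal ker)
          (use E_E that(1) linear_0[OF linear_complexify] in \<open>auto simp: commutator_complexify\<close>)
      then show ?thesis using that(2) by blast
    qed
    have "b \<subseteq> {Y. commutator X Y = 0}"
      unfolding b_def
    proof (intro span_minimal ker subsetI)
      fix Z assume "Z \<in> (\<lambda>i. complexify (E i)) ` {..<?q}"
      then have "commutator Z X = 0" using 1 X by auto
      then show "Z \<in> {Y. commutator X Y = 0}" by (simp add: commutator_def)
    qed
    then show ?thesis using Y by blast
  qed
  moreover have "abelian_subalgebra b"
    unfolding abelian_subalgebra_def lie_subalgebra_def
  proof (intro conjI ballI b_comm)
    show sb: "subspace b" unfolding b_def by (rule subspace_span)
    show "commutator X Y \<in> b" if "X \<in> b" "Y \<in> b" for X Y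
      using b_comm[OF that] subspace_0[OF sb] by simp
  qed
  ultimately have "b = a" by (intro max)
  then have "dim a = dim S"
    unfolding bS[symmetric, THEN sym] using dim_image_eq[OF linear_complexify, of S]
      inj_complexify by (metis bS inj_on_subset subset_UNIV)
  also have "dim S = ?q"
  proof -
    \<comment> \<open>These functionals are dual to the generators: each reads off the coefficient
      of \<open>E i\<close>, which gives distinctness and independence at once.\<close>
    let ?f = "\<lambda>i (M :: real^'n^'n). u i \<bullet> (M *v v i)"
    have ker: "subspace {M. ?f i M = 0}" for i
      by (auto simp: subspace_def matrix_vector_mult_add_rdistrib inner_add_right
          scaleR_matrix_vector_assoc[symmetric])
    have f_E: "?f i (E j) = of_bool (i = j)" if "i < ?q" "j < ?q" for i j
      using E_v[OF that(2,1)] uu[OF that] uu[OF that(1) that(1)] by simp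
    have inj: "inj_on E {..<?q}"
    proof (rule inj_onI)
      fix i j assume ij: "i \<in> {..<?q}" "j \<in> {..<?q}" "E i = E j"
      then have "?f i (E i) = ?f i (E j)" by simp
      then show "i = j" using f_E[of i i] f_E[of i j] ij by (simp split: if_splits)
    qed
    have "independent (E ` {..<?q})"
      unfolding dependent_def
    proof (intro notI, elim bexE)
      fix M assume M: "M \<in> E ` {..<?q}" "M \<in> span (E ` {..<?q} - {M})"
      then obtain i where i: "i < ?q" "M = E i" by auto
      have "E ` {..<?q} - {M} \<subseteq> {M. ?f i M = 0}"
        using i f_E by auto
      then have "span (E ` {..<?q} - {M}) \<subseteq> {M. ?f i M = 0}"
        by (rule span_minimal[OF _ ker])
      then have "?f i M = 0" using M(2) by blast
      then show False using f_E[OF i(1) i(1)] i(2) by simp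
    qed
    then have "dim S = card (E ` {..<?q})" unfolding S_def by (simp add: dim_span dim_eq_card_independent)
    then show ?thesis using card_image[OF inj] by simp
  qed
  finally show ?thesis .
qed

theorem theorem1:
  fixes d1 d2 r1 q1 r2 q2 :: nat
    and U1 :: "'a::finite set" and U2 :: "'b::finite set"
  assumes "CARD('a) = d1" and "CARD('b) = d2"
    and "d1 \<ge> 2" and "d2 \<ge> 2" and "d1 > 2 \<or> d2 > 2"
    and "r1 \<ge> q1" and "q1 \<ge> 1" and "r1 + q1 = d1"
    and "r2 \<ge> q2" and "q2 \<ge> 1" and "r2 + q2 = d2"
    and "card U1 = r1" and "card U2 = r2"
  shows "cartan_decomposition (frak_k :: (complex^('a \<times> 'b)^('a \<times> 'b)) set)
           (frak_k' U1 U2) (frak_p' U1 U2) \<and>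
         cartan_decomposition_BDI (r1 * r2 + q1 * q2) (r1 * q2 + q1 * r2)
           (frak_k' U1 U2) (frak_p' U1 U2) \<and>
         (\<forall>a. cartan_subalgebra (frak_p' U1 U2) a \<longrightarrow> dim a = r1 * q2 + q1 * r2)"
proof -
  let ?W = "block_prod U1 U2"
  let ?r = "r1 * r2 + q1 * q2" and ?q = "r1 * q2 + q1 * r2"
  have N: "CARD('a \<times> 'b) = (r1 + q1) * (r2 + q2)" using assms by simp
  have "2 * 2 \<le> (r1 + q1) * (r2 + q2)" using assms by (intro mult_le_mono) auto
  then have N3: "CARD('a \<times> 'b) \<ge> 3" using N by linarith
  have sum: "?r + ?q = CARD('a \<times> 'b)" unfolding N by (simp add: algebra_simps)
  \<comment> \<open>With the excesses \<open>s1\<close> and \<open>s2\<close> of the upper blocks,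
    \<open>?r - ?q\<close> is the product \<open>s1 * s2\<close>; the substitution keeps the
    comparison free of truncated subtraction.\<close>
  obtain s1 s2 where s: "r1 = q1 + s1" "r2 = q2 + s2"
    using assms(6,9) by (metis le_Suc_ex)
  have rq: "?q \<le> ?r" unfolding s by (simp add: algebra_simps)
  have "1 * 1 \<le> r1 * q2" using assms by (intro mult_le_mono) auto
  then have q1: "?q \<ge> 1" by linarith
  have W: "card ?W = ?r"
    unfolding card_block_prod using assms by (metis add_diff_cancel_left')
  have W': "card (- ?W) = ?q"
    using W sum by (simp add: Compl_eq_Diff_UNIV card_Diff_subset)
  show ?thesis
    unfolding frak_k_eq frak_k'_eq frak_p'_eq
    using cartan_decomposition_so_alg[OF N3, of ?W]
      cartan_decomposition_BDI_so_alg[OF N3 q1 rq sum W] dim_cartan_subalgebra[of ?W] W W' rq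
    by metis
qed

end
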